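(* Let $(T,f)$ be a minimal Hubbard tree (with periodic critical point), with kneading sequence $\nu$, and let $p\in T$ be a periodic non-precritical point of period $n$ and itinerary $\tau$ such that $]c_0,c_1]\cap\,]c_0,p]=:\,]c_0,b]$ is not empty. Set $\tilde\nu:=\mathcal{A}_n^{-1}(\tau)$ and let $(\widetilde T,\tilde f)$ be the (minimal) Hubbard tree associated to the kneading sequence $\tilde\nu$. Suppose that $z\in\,]b,c_1[$ is a characteristic point such that either there is a characteristic point $y\neq p$ in $[b,z[$, or $b$ is the limit of characteristic points in $]c_0,b[$. Then there is no characteristic point $\tilde z$ with itinerary $\tau(z)$ in $\widetilde T$.
   Context: Conventions: $f^{\circ n}$ is the $n$-th iterate; $\mathrm{orb}(x)=\{f^{\circ n}(x):n\ge 0\}$; periods are exact; $\overline{w}$ is the infinite repetition of the word $w$. A tree is a connected compact metric space that is a finite union of arcs and contains no simple closed curve. Endpoints and branch points are points whose complement has one, respectively more than two, components. $[x,y]$ is the unique closed arc joining $x,y$; $]x,y[$, $]x,y]$, $[x,y[$ omit the corresponding endpoints. A Hubbard tree $(T,f)$ is a tree $T$ with a continuous surjective map $f:T\to T$ and a critical point $c_0\in T$ such that: (a) $f$ is at most 2-to-1; (b) $f$ is locally 1-to-1 on $T\setminus\{c_0\}$; (c) all endpoints of $T$ are in $\mathrm{orb}(c_0)$; (d) $c_0$ is periodic; (e) if $x\ne y$ are marked points (branch points or points of $\mathrm{orb}(c_0)$), then $c_0\in f^{\circ n}([x,y])$ for some $n\ge0$. The critical value is $c_1=f(c_0)$. A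 point $\xi$ is precritical if $f^{\circ k}(\xi)=c_1$ for some $k>0$. $T\setminus\{c_0\}$ has at most two components; $T_1$ is the one containing $c_1$, $T_0$ the other (possibly empty). The itinerary $\tau(z)$ of $z\in T$ has $i$-th entry $0,\star,1$ according as $f^{\circ(i-1)}(z)\in T_0$, $=c_0$, $\in T_1$. The kneading sequence of $(T,f)$ is $\tau(c_1)$. If $c_0$ has period $m$, $(T,f)$ has attracting dynamics if each $c_i\in\mathrm{orb}(c_0)$ has a neighborhood $U_i$ with $f^{\circ jm}(x)\to c_i$ as $j\to\infty$ for all $x\in U_i$. $(T,f)$ is minimal if it has attracting dynamics and no two distinct periodic points have the same itinerary. Every $\star$-periodic sequence, i.e. every sequence $\overline{1\nu_2\ldots\nu_{n-1}\star}$ with $\nu_i\in\{0,1\}$ or $\overline{\star}$, is the kneading sequence of a Hubbard tree, unique up to combinatorial equivalence, which can be taken minimal. Given a periodic orbit disjoint from $\mathrm{orb}(c_0)$, its points can be labelled uniquely as $z_1,\ldots,z_n$ with $f(z_i)=z_{i+1}$ (indices mod $n$) such that one component of $T\setminus\{z_1\}$ contains $c_1$ and one other component contains $c_0$ and $z_2,\ldots,z_n$; $z_1$ is the characteristic point of this orbit. For a periodic sequence $\tau$ over $\{0,1\}$, $\mathcal{A}_n^{-1}(\tau)$ is obtained from $\tau$ by replacing the $jn$-th entry by $\star$ for all $j\in\mathbb{N}$. *)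

theory Defs
  imports "HOL-Analysis.Analysis"
begin

section \<open>Trees\<close>

text \<open>
  Trees are carrier sets in an ambient metric space; the topology is the subspace topology.
  A single point counts as a tree (a degenerate arc): it carries the Hubbard tree whose
  kneading sequence is the constant sequence of stars.
\<close>

definition is_tree :: "'a::metric_space set \<Rightarrow> bool" where
  "is_tree T \<longleftrightarrow>
     T \<noteq> {} \<and> connected T \<and> compact T \<and>
     ((\<exists>x. T = {x}) \<or>
      (\<exists>G. finite G \<and> (\<forall>g\<in>G. arc g) \<and> T = (\<Union>g\<in>G. path_image g))) \<and>
     \<not> (\<exists>g. simple_path g \<and> pathfinish g = pathstart g \<and> path_image g \<subseteq> T)"

definition endpoints :: "'a::metric_space set \<Rightarrow> 'a set" where
  "endpoints T = {x \<in> T. card (components (T - {x})) = 1}"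

text \<open>More than two components; written so as to include infinitely many.\<close>

definition branch_points :: "'a::metric_space set \<Rightarrow> 'a set" where
  "branch_points T =
     {x \<in> T. \<not> (finite (components (T - {x})) \<and> card (components (T - {x})) \<le> 2)}"

definition arc_cc :: "'a::metric_space set \<Rightarrow> 'a \<Rightarrow> 'a \<Rightarrow> 'a set" where
  "arc_cc T x y =
     (if x = y then {x}
      else (THE A. A \<subseteq> T \<and> (\<exists>g. arc g \<and> pathstart g = x \<and> pathfinish g = y \<and> path_image g = A)))"

definition arc_oo :: "'a::metric_space set \<Rightarrow> 'a \<Rightarrow> 'a \<Rightarrow> 'a set" where
  "arc_oo T x y = arc_cc T x y - {x, y}"

definition arc_oc :: "'a::metric_space set \<Rightarrow> 'a \<Rightarrow> 'a \<Rightarrow> 'a set" where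
  "arc_oc T x y = arc_cc T x y - {x}"

definition arc_co :: "'a::metric_space set \<Rightarrow> 'a \<Rightarrow> 'a \<Rightarrow> 'a set" where
  "arc_co T x y = arc_cc T x y - {y}"

section \<open>Hubbard trees\<close>

definition orb :: "('a \<Rightarrow> 'a) \<Rightarrow> 'a \<Rightarrow> 'a set" where
  "orb f x = range (\<lambda>n. (f ^^ n) x)"

definition has_period :: "('a \<Rightarrow> 'a) \<Rightarrow> 'a \<Rightarrow> nat \<Rightarrow> bool" where
  "has_period f x n \<longleftrightarrow> n > 0 \<and> (f ^^ n) x = x \<and> (\<forall>k. 0 < k \<and> k < n \<longrightarrow> (f ^^ k) x \<noteq> x)"

definition is_periodic :: "('a \<Rightarrow> 'a) \<Rightarrow> 'a \<Rightarrow> bool" where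
  "is_periodic f x \<longleftrightarrow> (\<exists>n. has_period f x n)"

definition marked_points :: "'a::metric_space set \<Rightarrow> ('a \<Rightarrow> 'a) \<Rightarrow> 'a \<Rightarrow> 'a set" where
  "marked_points T f c0 = branch_points T \<union> orb f c0"

text \<open>
  The critical point \<open>c0\<close> is only required to satisfy the listed axioms; \<open>f\<close> need not be
  2-to-1 near it (for the tree with kneading sequence \<open>1\<close>, star, \<open>1\<close>, star, \<open>\<dots>\<close> it is injective).
\<close>

definition hubbard_tree :: "'a::metric_space set \<Rightarrow> ('a \<Rightarrow> 'a) \<Rightarrow> 'a \<Rightarrow> bool" where
  "hubbard_tree T f c0 \<longleftrightarrow>
     is_tree T \<and> continuous_on T f \<and> f ` T = T \<and> c0 \<in> T \<and>
     (\<forall>y\<in>T. finite {x \<in> T. f x = y} \<and> card {x \<in> T. f x = y} \<le> 2) \<and>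
     (\<forall>x\<in>T - {c0}. \<exists>U. openin (top_of_set T) U \<and> x \<in> U \<and> inj_on f U) \<and>
     endpoints T \<subseteq> orb f c0 \<and>
     is_periodic f c0 \<and>
     (\<forall>x\<in>marked_points T f c0. \<forall>y\<in>marked_points T f c0.
        x \<noteq> y \<longrightarrow> (\<exists>n. c0 \<in> (f ^^ n) ` arc_cc T x y))"

definition precritical :: "('a \<Rightarrow> 'a) \<Rightarrow> 'a \<Rightarrow> 'a \<Rightarrow> bool" where
  "precritical f c0 x \<longleftrightarrow> (\<exists>k>0. (f ^^ k) x = f c0)"

section \<open>Itineraries\<close>

datatype symbol = Zero | Star | One

definition T1_part :: "'a::metric_space set \<Rightarrow> ('a \<Rightarrow> 'a) \<Rightarrow> 'a \<Rightarrow> 'a set" where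
  "T1_part T f c0 = connected_component_set (T - {c0}) (f c0)"

text \<open>
  In a Hubbard tree \<open>T - {c0}\<close> has at most two components, so the following is the other
  component, or empty.
\<close>

definition T0_part :: "'a::metric_space set \<Rightarrow> ('a \<Rightarrow> 'a) \<Rightarrow> 'a \<Rightarrow> 'a set" where
  "T0_part T f c0 = (T - {c0}) - T1_part T f c0"

text \<open>
  Sequences are indexed from \<open>0\<close>: the \<open>i\<close>-th entry of a sequence \<open>\<tau>\<close> in the usual
  numbering from \<open>1\<close> is \<open>\<tau> (i - 1)\<close>.
\<close>

definition itinerary :: "'a::metric_space set \<Rightarrow> ('a \<Rightarrow> 'a) \<Rightarrow> 'a \<Rightarrow> 'a \<Rightarrow> nat \<Rightarrow> symbol" where
  "itinerary T f c0 z = (\<lambda>i.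
     if (f ^^ i) z = c0 then Star
     else if (f ^^ i) z \<in> T1_part T f c0 then One
     else Zero)"

lemma itinerary_Zero_iff:
  assumes "f ` T = T" and "z \<in> T"
  shows "itinerary T f c0 z i = Zero \<longleftrightarrow> (f ^^ i) z \<in> T0_part T f c0"
proof -
  have "(f ^^ i) z \<in> T"
    using assms by (induction i) auto
  then show ?thesis
    by (auto simp: itinerary_def T0_part_def)
qed

definition kneading_sequence :: "'a::metric_space set \<Rightarrow> ('a \<Rightarrow> 'a) \<Rightarrow> 'a \<Rightarrow> nat \<Rightarrow> symbol" where
  "kneading_sequence T f c0 = itinerary T f c0 (f c0)"

text \<open>\<open>A_inv n \<tau>\<close> is \<open>\<A>\<^sub>n\<close> to the power \<open>-1\<close>, applied to \<open>\<tau>\<close>;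
  entry number \<open>j * n\<close> has index \<open>j * n - 1\<close> here.\<close>

definition A_inv :: "nat \<Rightarrow> (nat \<Rightarrow> symbol) \<Rightarrow> nat \<Rightarrow> symbol" where
  "A_inv n \<tau> = (\<lambda>i. if n dvd Suc i then Star else \<tau> i)"

section \<open>Minimal Hubbard trees and characteristic points\<close>

definition attracting_dynamics :: "'a::metric_space set \<Rightarrow> ('a \<Rightarrow> 'a) \<Rightarrow> 'a \<Rightarrow> bool" where
  "attracting_dynamics T f c0 \<longleftrightarrow>
     (\<exists>m. has_period f c0 m \<and>
       (\<forall>c\<in>orb f c0. \<exists>U. openin (top_of_set T) U \<and> c \<in> U \<and>
          (\<forall>x\<in>U. (\<lambda>j. (f ^^ (j * m)) x) \<longlonglongrightarrow> c)))"

definition minimal_hubbard_tree :: "'a::metric_space set \<Rightarrow> ('a \<Rightarrow> 'a) \<Rightarrow> 'a \<Rightarrow> bool" where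
  "minimal_hubbard_tree T f c0 \<longleftrightarrow>
     hubbard_tree T f c0 \<and> attracting_dynamics T f c0 \<and>
     (\<forall>x\<in>T. \<forall>y\<in>T. is_periodic f x \<and> is_periodic f y \<and>
        itinerary T f c0 x = itinerary T f c0 y \<longrightarrow> x = y)"

definition characteristic_point :: "'a::metric_space set \<Rightarrow> ('a \<Rightarrow> 'a) \<Rightarrow> 'a \<Rightarrow> 'a \<Rightarrow> bool" where
  "characteristic_point T f c0 z \<longleftrightarrow>
     z \<in> T \<and> orb f z \<inter> orb f c0 = {} \<and>
     (\<exists>n. has_period f z n \<and>
       (\<exists>C\<in>components (T - {z}). \<exists>D\<in>components (T - {z}).
          C \<noteq> D \<and> f c0 \<in> C \<and> c0 \<in> D \<and> (\<forall>k. 0 < k \<and> k < n \<longrightarrow> (f ^^ k) z \<in> D)))"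

end

theory Submission
  imports Defs
begin

text \<open>Let \<open>y\<close> be the given characteristic point, or \<open>y = b\<close> in the limit case. The directions at
  \<open>y\<close> towards \<open>z\<close> and \<open>p\<close> differ, and no iterate of \<open>y\<close> is beyond \<open>z\<close>. How the directions at
  \<open>y\<close> towards the orbit of \<open>z\<close> are mapped is then determined by the itineraries of \<open>y\<close> and \<open>z\<close>
  alone: whenever the critical point cuts off such a direction, it becomes the direction towards the
  critical value, which is the one towards \<open>z\<close>. Suppose that \<open>z'\<close> exists in \<open>T'\<close>. A covering
  argument gives a point \<open>y'\<close> there with the itinerary of \<open>y\<close>, whose directions are mapped in the
  same way. The critical value of \<open>T'\<close> has the itinerary of \<open>p\<close> up to stars, but it lies beyond
  \<open>z'\<close>, so that \<open>y'\<close> sees it in the direction of \<open>z'\<close>. At the first time when the itineraries of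
  \<open>y\<close> and \<open>p\<close> differ, the direction towards \<open>p\<close>, respectively the critical value, becomes the one
  towards \<open>z\<close>, respectively \<open>z'\<close>. So two directions that are distinct in \<open>T\<close> coincide in
  \<open>T'\<close> although they have the same symbolic description. The branch point of such a pair in \<open>T'\<close> is
  eventually periodic and has the itinerary of an iterate of \<open>y'\<close>; since \<open>y'\<close> can be chosen so that
  this iterate is the branch point, the directions are distinct after all. If the itineraries of
  \<open>y\<close> and \<open>p\<close> agree, then \<open>z'\<close>, which is between \<open>y'\<close> and the critical value, has the same
  itinerary too.\<close>

section \<open>Arcs in metric spaces\<close>

definition subarc :: "real \<Rightarrow> real \<Rightarrow> (real \<Rightarrow> 'a) \<Rightarrow> real \<Rightarrow> 'a" where
  "subarc a b g = (\<lambda>x. g ((b - a) * x + a))"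

lemma subarc_ends [simp]: "pathstart (subarc a b g) = g a" "pathfinish (subarc a b g) = g b"
  by (auto simp: subarc_def pathstart_def pathfinish_def)

lemma path_image_subarc: "path_image (subarc a b g) = g ` closed_segment a b"
  by (auto simp: path_image_def subarc_def closed_segment_real_eq)

lemma arc_subarc:
  fixes g :: "real \<Rightarrow> 'a::topological_space"
  assumes "continuous_on (closed_segment a b) g" "inj_on g (closed_segment a b)" "a \<noteq> b"
  shows "arc (subarc a b g)"
proof -
  have im: "(\<lambda>x. (b - a) * x + a) ` {0..1} = closed_segment a b"
    by (simp add: closed_segment_real_eq)
  have "continuous_on {0..1} (g \<circ> (\<lambda>x. (b - a) * x + a))"
    by (rule continuous_on_compose) (intro continuous_intros, use assms im in simp)
  moreover have "inj_on (g \<circ> (\<lambda>x. (b - a) * x + a)) {0..1}"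
    by (rule comp_inj_on) (use assms im in \<open>auto simp: inj_on_def\<close>)
  ultimately show ?thesis
    by (simp add: arc_def path_def subarc_def comp_def)
qed

lemma arc_subarc_unit:
  fixes g :: "real \<Rightarrow> 'a::topological_space"
  assumes "arc g" "a \<in> {0..1}" "b \<in> {0..1}" "a \<noteq> b"
  shows "arc (subarc a b g)" "path_image (subarc a b g) \<subseteq> path_image g"
proof -
  have sub: "closed_segment a b \<subseteq> {0..1}"
    using assms by (auto simp: closed_segment_eq_real_ivl)
  show "arc (subarc a b g)"
    using assms sub by (intro arc_subarc) (auto simp: arc_def path_def inj_on_def intro: continuous_on_subset)
  show "path_image (subarc a b g) \<subseteq> path_image g"
    unfolding path_image_subarc using sub by (auto simp: path_image_def)
qed

lemma closed_path_image_arc: "arc g \<Longrightarrow> closed (path_image (g :: real \<Rightarrow> 'a::metric_space))"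
  by (simp add: arc_imp_path compact_imp_closed compact_path_image)

text \<open>The case \<open>x = y\<close> is separate because \<open>arc\<close> excludes constant
  paths; with it the relation is an equivalence on \<open>S\<close>.\<close>

definition joined :: "'a::metric_space set \<Rightarrow> 'a \<Rightarrow> 'a \<Rightarrow> bool" where
  "joined S x y \<longleftrightarrow> x \<in> S \<and> y \<in> S \<and>
     (x = y \<or> (\<exists>g. arc g \<and> path_image g \<subseteq> S \<and> pathstart g = x \<and> pathfinish g = y))"

lemma joined_refl: "x \<in> S \<Longrightarrow> joined S x x"
  by (simp add: joined_def)

lemma joined_subarc:
  fixes g :: "real \<Rightarrow> 'a::metric_space"
  assumes "arc g" "a \<in> {0..1}" "b \<in> {0..1}" "g ` closed_segment a b \<subseteq> S"
  shows "joined S (g a) (g b)"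
proof (cases "a = b")
  case True
  then show ?thesis using assms by (auto simp: joined_def)
next
  case False
  have "g a \<in> S" "g b \<in> S" using assms by auto
  moreover have "arc (subarc a b g)" using arc_subarc_unit assms False by blast
  ultimately show ?thesis
    unfolding joined_def using assms(4) path_image_subarc subarc_ends by metis
qed

text \<open>The first arc is followed until it first meets the second one, and the second from there
  on; the two pieces then share only the switching point.\<close>

lemma joined_trans:
  fixes x :: "'a::metric_space"
  assumes "joined S x y" "joined S y z"
  shows "joined S x z"
proof (cases "x = y \<or> y = z")
  case True
  then show ?thesis using assms by auto
next
  case False
  obtain g where g: "arc g" "path_image g \<subseteq> S" "pathstart g = x" "pathfinish g = y"
    using assms False by (auto simp: joined_def)
  obtain h where h: "arc h" "path_image h \<subseteq> S" "pathstart h = y" "pathfinish h = z"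
    using assms False by (auto simp: joined_def)
  define Z where "Z = {0..1} \<inter> g -` path_image h"
  have cg: "continuous_on {0..1} g" using g by (simp add: arc_def path_def)
  have "closed Z"
    unfolding Z_def using cg closed_path_image_arc h(1) by (intro continuous_closed_preimage) auto
  moreover have "bounded Z" unfolding Z_def by (rule bounded_subset[of "{0..1}"]) auto
  ultimately have "compact Z" by (simp add: compact_eq_bounded_closed)
  moreover have "1 \<in> Z"
    using g(4) h(3) pathstart_in_path_image[of h] by (simp add: Z_def pathfinish_def)
  ultimately obtain t where t: "t \<in> Z" "\<And>s. s \<in> Z \<Longrightarrow> t \<le> s"
    using compact_attains_inf[of Z] by auto
  then obtain s where s: "s \<in> {0..1}" "g t = h s" by (auto simp: Z_def path_image_def)
  have t01: "t \<in> {0..1}" using t by (auto simp: Z_def)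
  have gx: "g 0 = x" and hz: "h 1 = z" using g h by (auto simp: pathstart_def pathfinish_def)
  have first: "g ` closed_segment 0 t \<inter> path_image h \<subseteq> {g t}"
  proof -
    have "r = t" if "r \<in> closed_segment 0 t" "g r \<in> path_image h" for r
      using t(2)[of r] that t01 by (auto simp: Z_def closed_segment_eq_real_ivl)
    then show ?thesis by auto
  qed
  have imh: "h ` closed_segment s 1 \<subseteq> path_image h"
    using s by (auto simp: path_image_def closed_segment_eq_real_ivl)
  have img: "g ` closed_segment 0 t \<subseteq> path_image g"
    using t01 by (auto simp: path_image_def closed_segment_eq_real_ivl)
  show ?thesis
  proof (cases "t = 0 \<or> s = 1")
    \<comment> \<open>One of the two pieces is a single point, so the other one alone does the
      joining.\<close>
    case True
    then show ?thesis
      using joined_subarc[OF h(1), of s 1 S] joined_subarc[OF g(1), of 0 t S] s t01 imh img g(2) h(2)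
      by (auto simp: gx hz)
  next
    case False
    let ?p = "subarc 0 t g" and ?q = "subarc s 1 h"
    have "arc ?p" "arc ?q"
      using arc_subarc_unit[OF g(1), of 0 t] arc_subarc_unit[OF h(1), of s 1] t01 s False by auto
    moreover have "path_image ?p \<inter> path_image ?q \<subseteq> {pathstart ?q}"
      using first imh s by (auto simp: path_image_subarc)
    ultimately have "arc (?p +++ ?q)"
      using s by (intro arc_join) auto
    moreover have "path_image (?p +++ ?q) \<subseteq> S"
      using imh img g(2) h(2) s by (subst path_image_join) (auto simp: path_image_subarc)
    ultimately show ?thesis
      using assms gx hz unfolding joined_def
      by (metis pathfinish_join pathstart_join subarc_ends)
  qed
qed

text \<open>In a finite union of relatively closed, arcwise joined pieces the set of points joined to a
  given one and its complement are both unions of pieces.\<close>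

lemma joined_closedin:
  fixes S :: "'a::metric_space set"
  assumes "finite P" "\<Union>P = S" "\<And>C. C \<in> P \<Longrightarrow> closedin (top_of_set S) C"
    and "\<And>C x y. C \<in> P \<Longrightarrow> x \<in> C \<Longrightarrow> y \<in> C \<Longrightarrow> joined S x y"
  shows "openin (top_of_set S) {w. joined S x w}"
    and "connected_component S x y \<Longrightarrow> joined S x y"
proof -
  let ?R = "{w. joined S x w}"
  have RS: "?R \<subseteq> S" by (auto simp: joined_def)
  have "?R = \<Union>{C\<in>P. C \<inter> ?R \<noteq> {}}"
  proof
    show "?R \<subseteq> \<Union>{C\<in>P. C \<inter> ?R \<noteq> {}}" using RS assms(2) by blast
    show "\<Union>{C\<in>P. C \<inter> ?R \<noteq> {}} \<subseteq> ?R" using assms(4) joined_trans by blast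
  qed
  moreover have "closedin (top_of_set S) (\<Union>{C\<in>P. C \<inter> ?R \<noteq> {}})"
    using assms by (intro closedin_Union) auto
  ultimately have cR: "closedin (top_of_set S) ?R" by simp
  have "S - ?R = \<Union>{C\<in>P. C \<inter> ?R = {}}"
  proof
    show "S - ?R \<subseteq> \<Union>{C\<in>P. C \<inter> ?R = {}}"
    proof
      fix w assume w: "w \<in> S - ?R"
      then obtain C where C: "C \<in> P" "w \<in> C" using assms(2) by blast
      have "C \<inter> ?R = {}"
        using w C assms(4) joined_trans by blast
      then show "w \<in> \<Union>{C\<in>P. C \<inter> ?R = {}}" using C by blast
    qed
    show "\<Union>{C\<in>P. C \<inter> ?R = {}} \<subseteq> S - ?R" using assms(2) by blast
  qed
  moreover have "closedin (top_of_set S) (\<Union>{C\<in>P. C \<inter> ?R = {}})"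
    using assms by (intro closedin_Union) auto
  ultimately have "closedin (top_of_set S) (S - ?R)" by simp
  then show oR: "openin (top_of_set S) ?R"
    using RS by (simp add: openin_closedin_eq)
  assume "connected_component S x y"
  then obtain K where K: "connected K" "K \<subseteq> S" "x \<in> K" "y \<in> K"
    by (auto simp: connected_component_def)
  have "openin (top_of_set K) (K \<inter> ?R)" "closedin (top_of_set K) (K \<inter> ?R)"
    using oR cR K(2) unfolding openin_open closedin_closed by blast+
  moreover have "x \<in> K \<inter> ?R" using K joined_refl by blast
  ultimately have "K \<inter> ?R = K" using K(1) unfolding connected_clopen by blast
  then show "joined S x y" using K by blast
qed

text \<open>Where \<open>h\<close> leaves \<open>g\<close>, a maximal excursion of \<open>h\<close>
  together with the part of \<open>g\<close> between its two ends would form a simple closed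
  curve.\<close>

lemma unique_arc_image:
  fixes T :: "'a::metric_space set"
  assumes nsc: "\<not> (\<exists>g. simple_path g \<and> pathfinish g = pathstart g \<and> path_image g \<subseteq> T)"
    and g: "arc g" "path_image g \<subseteq> T" and h: "arc h" "path_image h \<subseteq> T"
    and ends: "pathstart g = pathstart h" "pathfinish g = pathfinish h"
  shows "path_image h \<subseteq> path_image g"
proof (rule ccontr)
  assume "\<not> ?thesis"
  then obtain t where t: "t \<in> {0..1}" "h t \<notin> path_image g"
    unfolding path_image_def by blast
  define Z where "Z = {0..1} \<inter> h -` path_image g"
  have ch: "continuous_on {0..1} h" and ih: "inj_on h {0..1}" using h by (auto simp: arc_def path_def)
  have "closed Z"
    unfolding Z_def using ch closed_path_image_arc g(1) by (intro continuous_closed_preimage) auto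
  have cpt: "compact (Z \<inter> {0..t})" "compact (Z \<inter> {t..1})"
    using \<open>closed Z\<close> by (auto simp: closed_Int_compact)
  have "0 \<in> Z \<inter> {0..t}" "1 \<in> Z \<inter> {t..1}"
    using t ends by (auto simp: Z_def path_image_def pathstart_def pathfinish_def intro: image_eqI[of _ _ 0] image_eqI[of _ _ 1])
  \<comment> \<open>\<open>a\<close> and \<open>b\<close> are the last parameter before
    \<open>t\<close> and the first one after \<open>t\<close> at which \<open>h\<close> is on
    \<open>g\<close>.\<close>
  then obtain a b where a: "a \<in> Z \<inter> {0..t}" "\<And>s. s \<in> Z \<inter> {0..t} \<Longrightarrow> s \<le> a"
    and b: "b \<in> Z \<inter> {t..1}" "\<And>s. s \<in> Z \<inter> {t..1} \<Longrightarrow> b \<le> s"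
    using compact_attains_sup[OF cpt(1)] compact_attains_inf[OF cpt(2)] by blast
  obtain a' b' where a': "a' \<in> {0..1}" "h a = g a'" and b': "b' \<in> {0..1}" "h b = g b'"
    using a b by (auto simp: Z_def path_image_def)
  have "a \<noteq> t" "b \<noteq> t" using a(1) b(1) t(2) by (auto simp: Z_def)
  then have ab: "a < b" "a \<in> {0..1}" "b \<in> {0..1}" using a(1) b(1) t by auto
  then have "a' \<noteq> b'" using a'(2) b'(2) ih inj_onD[OF ih, of a b] by auto
  let ?p = "subarc a b h" and ?q = "subarc b' a' g"
  have "arc ?p" "arc ?q" "path_image ?p \<subseteq> T" "path_image ?q \<subseteq> T"
    using arc_subarc_unit[OF h(1), of a b] arc_subarc_unit[OF g(1), of b' a'] ab a' b' \<open>a' \<noteq> b'\<close>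
      g(2) h(2) by auto
  moreover have "path_image ?p \<inter> path_image ?q \<subseteq> {pathstart ?p, pathstart ?q}"
  proof
    fix w assume w: "w \<in> path_image ?p \<inter> path_image ?q"
    then obtain s where s: "a \<le> s" "s \<le> b" "w = h s"
      using ab by (auto simp: path_image_subarc closed_segment_eq_real_ivl)
    have "w \<in> path_image g"
      using w arc_subarc_unit(2)[OF g(1) b'(1) a'(1)] \<open>a' \<noteq> b'\<close> by auto
    then have "s \<in> Z" using s ab by (auto simp: Z_def)
    then have "s = a \<or> s = b" using a(2)[of s] b(2)[of s] s ab a(1) b(1) by force
    then show "w \<in> {pathstart ?p, pathstart ?q}" using s b' by auto
  qed
  ultimately have "simple_path (?p +++ ?q)"
    using a' b' by (intro simple_path_join_loop) auto
  moreover have "path_image (?p +++ ?q) \<subseteq> T"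
    using \<open>path_image ?p \<subseteq> T\<close> \<open>path_image ?q \<subseteq> T\<close> b' by (subst path_image_join) auto
  moreover have "pathfinish (?p +++ ?q) = pathstart (?p +++ ?q)" using a' by simp
  ultimately show False using nsc by blast
qed

lemma injective_loop:
  fixes g :: "real \<Rightarrow> 'a::topological_space"
  assumes "continuous_on {a..b} g" "a < b" "g a = g b"
    and "\<And>s t. a \<le> s \<Longrightarrow> s < t \<Longrightarrow> t \<le> b \<Longrightarrow> g s = g t \<Longrightarrow> s = a \<and> t = b"
  shows "simple_path (subarc a b g)"
proof -
  let ?l = "\<lambda>x. (b - a) * x + a"
  have im: "?l ` {0..1} = {a..b}"
    using assms(2) closed_segment_real_eq[of a b] by (simp add: closed_segment_eq_real_ivl)
  have "continuous_on {0..1} (g \<circ> ?l)"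
    by (rule continuous_on_compose) (intro continuous_intros, use assms im in simp)
  moreover have "s = t \<or> s = 0 \<and> t = 1 \<or> s = 1 \<and> t = 0"
    if st: "s \<in> {0..1}" "t \<in> {0..1}" "g (?l s) = g (?l t)" for s t
  proof -
    have mem: "?l s \<in> {a..b}" "?l t \<in> {a..b}" using st im by blast+
    have eq: "?l s = ?l t \<or> ?l s = a \<and> ?l t = b \<or> ?l s = b \<and> ?l t = a"
      using assms(4)[of "?l s" "?l t"] assms(4)[of "?l t" "?l s"] mem st(3) by fastforce
    have "?l s = a \<longleftrightarrow> s = 0" "?l t = a \<longleftrightarrow> t = 0" "?l s = ?l t \<longleftrightarrow> s = t"
      using assms(2) by auto
    moreover have "?l s = b \<longleftrightarrow> (b - a) * s = (b - a) * 1" "?l t = b \<longleftrightarrow> (b - a) * t = (b - a) * 1"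
      by (auto simp: algebra_simps)
    then have "?l s = b \<longleftrightarrow> s = 1" "?l t = b \<longleftrightarrow> t = 1"
      using assms(2) by auto
    ultimately show ?thesis using eq by metis
  qed
  ultimately show ?thesis
    by (auto simp: simple_path_def loop_free_def path_def subarc_def comp_def)
qed

section \<open>Segments of a tree\<close>

locale tree =
  fixes T :: "'a::metric_space set"
  assumes tree: "is_tree T"
begin

abbreviation seg :: "'a \<Rightarrow> 'a \<Rightarrow> 'a set" where
  "seg \<equiv> arc_cc T"

lemma no_loop: "simple_path g \<Longrightarrow> pathfinish g = pathstart g \<Longrightarrow> \<not> path_image g \<subseteq> T"
  using tree unfolding is_tree_def by blast

lemma tree_cases:
  obtains x where "T = {x}"
  | G where "finite G" "\<And>g. g \<in> G \<Longrightarrow> arc g" "T = (\<Union>g\<in>G. path_image g)"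
proof -
  have "(\<exists>x. T = {x}) \<or> (\<exists>G. finite G \<and> (\<forall>g\<in>G. arc g) \<and> T = (\<Union>g\<in>G. path_image g))"
    using tree unfolding is_tree_def by (elim conjE)
  then show ?thesis using that by metis
qed

text \<open>Taking \<open>V\<close> inside a singleton treats \<open>T\<close> and \<open>T\<close>
  minus a point together. Removing a point from an arc leaves at most two half-open arcs, so
  finitely many pieces suffice.\<close>

lemma tree_minus_pieces:
  assumes "V \<subseteq> {v}"
  obtains P where "finite P" "\<Union>P = T - V" "\<And>C. C \<in> P \<Longrightarrow> closedin (top_of_set (T - V)) C"
    "\<And>C x y. C \<in> P \<Longrightarrow> x \<in> C \<Longrightarrow> y \<in> C \<Longrightarrow> joined (T - V) x y"
proof (cases rule: tree_cases)
  case (1 x)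
  show ?thesis
    by (rule that[of "{T - V}"]) (auto simp: 1 joined_def)
next
  case (2 G)
  have ex: "\<exists>P. finite P \<and> \<Union>P = path_image g - V \<and>
      (\<forall>C\<in>P. closedin (top_of_set (T - V)) C \<and> (\<forall>x\<in>C. \<forall>y\<in>C. joined (T - V) x y))"
    if "g \<in> G" for g
  proof -
    have g: "arc g" "path_image g \<subseteq> T" using 2 that by auto
    have cg: "continuous_on {0..1} g" and ig: "inj_on g {0..1}" using g by (auto simp: arc_def path_def)
    have cl: "closed (g ` {a..b})" if "{a..b} \<subseteq> {0..1}" for a b :: real
      using cg that by (intro compact_imp_closed compact_continuous_image)
        (auto intro: continuous_on_subset)
    show ?thesis
    proof (cases "\<exists>t\<in>{0..1}. g t \<in> V")
      case False
      then have "path_image g - V = path_image g" by (auto simp: path_image_def)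
      moreover have "closedin (top_of_set (T - V)) (path_image g)"
        unfolding closedin_closed using closed_path_image_arc[OF g(1)] g(2) calculation by blast
      moreover have "joined (T - V) x y" if xy: "x \<in> path_image g" "y \<in> path_image g" for x y
      proof -
        obtain a b where "a \<in> {0..1}" "b \<in> {0..1}" "x = g a" "y = g b"
          using xy by (auto simp: path_image_def)
        moreover from this have "g ` closed_segment a b \<subseteq> path_image g"
          by (auto simp: path_image_def closed_segment_eq_real_ivl split: if_splits)
        ultimately show ?thesis
          using joined_subarc[OF g(1), of a b "T - V"] g(2) \<open>path_image g - V = path_image g\<close> by auto
      qed
      ultimately show ?thesis by (intro exI[of _ "{path_image g}"]) auto
    next
      case True
      then obtain t where t: "t \<in> {0..1}" "V = {g t}" using assms by blast
      have inj: "g s = g t \<longleftrightarrow> s = t" if "s \<in> {0..1}" for s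
        using ig t(1) that by (auto simp: inj_on_def)
      have j: "joined (T - V) (g a) (g b)"
        if "a \<in> {0..1}" "b \<in> {0..1}" "t \<notin> closed_segment a b" for a b
      proof (rule joined_subarc[OF g(1)])
        show "g ` closed_segment a b \<subseteq> T - V"
        proof
          fix w assume "w \<in> g ` closed_segment a b"
          then obtain s where s: "s \<in> closed_segment a b" "w = g s" by blast
          then have "s \<in> {0..1}" "s \<noteq> t"
            using that by (auto simp: closed_segment_eq_real_ivl split: if_splits)
          then show "w \<in> T - V" using s inj t(2) g(2) by (auto simp: path_image_def)
        qed
      qed (use that in auto)
      \<comment> \<open>The only limit point that a half-open piece can lack is the removed one, so
        the piece is closed in \<open>T - V\<close>.\<close>
      have e: "g ` {0..<t} = (T - V) \<inter> g ` {0..t}" "g ` {t<..1} = (T - V) \<inter> g ` {t..1}"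
      proof -
        have *: "g ` A = (T - V) \<inter> g ` (insert t A)" if "A \<subseteq> {0..1} - {t}" for A
        proof -
          have "g ` A \<subseteq> T - V" using that inj t(2) g(2) by (auto simp: path_image_def)
          then show ?thesis using t(2) by blast
        qed
        have "insert t {0..<t} = {0..t}" "insert t {t<..1} = {t..1}" using t(1) by auto
        then show "g ` {0..<t} = (T - V) \<inter> g ` {0..t}" "g ` {t<..1} = (T - V) \<inter> g ` {t..1}"
          using *[of "{0..<t}"] *[of "{t<..1}"] t(1) by (simp_all add: subset_iff)
      qed
      have "closedin (top_of_set (T - V)) (g ` {0..<t})" "closedin (top_of_set (T - V)) (g ` {t<..1})"
        unfolding e using cl t(1) by (auto intro!: closedin_closed_Int)
      moreover have "\<forall>x\<in>g ` {0..<t}. \<forall>y\<in>g ` {0..<t}. joined (T - V) x y"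
        "\<forall>x\<in>g ` {t<..1}. \<forall>y\<in>g ` {t<..1}. joined (T - V) x y"
        using t(1) by (auto intro!: j simp: closed_segment_eq_real_ivl split: if_splits)
      moreover have "\<Union>{g ` {0..<t}, g ` {t<..1}} = path_image g - V"
      proof -
        have "{0..<t} \<union> {t<..1} = {0..1} - {t}" using t(1) by auto
        then have "\<Union>{g ` {0..<t}, g ` {t<..1}} = g ` ({0..1} - {t})"
          by (simp add: image_Un[symmetric])
        also have "\<dots> = path_image g - V"
          using inj_on_image_set_diff[OF ig, of "{0..1}" "{t}"] t by (auto simp: path_image_def)
        finally show ?thesis .
      qed
      ultimately show ?thesis
        by (intro exI[of _ "{g ` {0..<t}, g ` {t<..1}}"]) auto
    qed
  qed
  obtain Q where Q: "\<And>g. g \<in> G \<Longrightarrow> finite (Q g) \<and> \<Union>(Q g) = path_image g - V \<and>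
      (\<forall>C\<in>Q g. closedin (top_of_set (T - V)) C \<and> (\<forall>x\<in>C. \<forall>y\<in>C. joined (T - V) x y))"
    using ex by metis
  show ?thesis
  proof (rule that[of "\<Union>(Q ` G)"])
    have "\<Union>(\<Union>(Q ` G)) = (\<Union>g\<in>G. \<Union>(Q g))" by blast
    also have "\<dots> = (\<Union>g\<in>G. path_image g - V)" using Q by auto
    finally show "\<Union>(\<Union>(Q ` G)) = T - V" using 2(3) by auto
  qed (use Q 2(1) in auto)
qed

lemma joined_if_connected: "V \<subseteq> {v} \<Longrightarrow> connected_component (T - V) x y \<Longrightarrow> joined (T - V) x y"
  using joined_closedin(2) tree_minus_pieces by metis

lemma openin_joined: "V \<subseteq> {v} \<Longrightarrow> openin (top_of_set (T - V)) {w. joined (T - V) x w}"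
  using joined_closedin(1) tree_minus_pieces by metis

lemma joined_tree: "x \<in> T \<Longrightarrow> y \<in> T \<Longrightarrow> joined T x y"
  using joined_if_connected[of "{}" x x y] tree
  by (auto simp: is_tree_def connected_iff_connected_component)

lemma seg_eq:
  assumes "arc g" "path_image g \<subseteq> T" "pathstart g = x" "pathfinish g = y"
  shows "seg x y = path_image g"
proof -
  have "x \<noteq> y" using assms arc_distinct_ends by blast
  have "(THE A. A \<subseteq> T \<and> (\<exists>g. arc g \<and> pathstart g = x \<and> pathfinish g = y \<and> path_image g = A)) = path_image g"
  proof (rule the_equality)
    show "A = path_image g"
      if "A \<subseteq> T \<and> (\<exists>g. arc g \<and> pathstart g = x \<and> pathfinish g = y \<and> path_image g = A)" for A
      using that unique_arc_image[of T] no_loop assms by (metis subset_antisym)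
  qed (use assms in auto)
  then show ?thesis using \<open>x \<noteq> y\<close> by (simp add: arc_cc_def)
qed

lemma seg_arc:
  assumes "x \<in> T" "y \<in> T" "x \<noteq> y"
  obtains g where "arc g" "path_image g = seg x y" "path_image g \<subseteq> T" "pathstart g = x" "pathfinish g = y"
  using joined_tree[OF assms(1,2)] assms(3) seg_eq unfolding joined_def by metis

lemma seg_refl [simp]: "seg x x = {x}"
  by (simp add: arc_cc_def)

lemma seg_subset: "x \<in> T \<Longrightarrow> y \<in> T \<Longrightarrow> seg x y \<subseteq> T"
  by (cases "x = y") (use seg_arc[of x y] in auto)

lemma seg_ends: "x \<in> T \<Longrightarrow> y \<in> T \<Longrightarrow> x \<in> seg x y" "x \<in> T \<Longrightarrow> y \<in> T \<Longrightarrow> y \<in> seg x y"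
  by (cases "x = y", simp, metis seg_arc pathstart_in_path_image pathfinish_in_path_image)+

lemma seg_sym: 
  assumes "x \<in> T" "y \<in> T" shows "seg x y = seg y x"
proof (cases "x = y")
  case False
  then obtain g where "arc g" "path_image g = seg x y" "path_image g \<subseteq> T" "pathstart g = x" "pathfinish g = y"
    using seg_arc assms by metis
  then show ?thesis
    using seg_eq[of "reversepath g" y x] by (simp add: arc_reversepath)
qed simp

lemma seg_connected: "x \<in> T \<Longrightarrow> y \<in> T \<Longrightarrow> connected (seg x y)"
  by (cases "x = y") (simp, metis seg_arc arc_imp_path connected_path_image)

lemma seg_compact: "x \<in> T \<Longrightarrow> y \<in> T \<Longrightarrow> compact (seg x y)"
  by (cases "x = y") (simp, metis seg_arc arc_imp_path compact_path_image)

lemma joined_minus_iff: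
  assumes "x \<in> T" "y \<in> T" "x \<noteq> v" "y \<noteq> v"
  shows "joined (T - {v}) x y \<longleftrightarrow> v \<notin> seg x y"
proof (cases "x = y")
  case False
  then obtain g where "arc g" "path_image g = seg x y" "path_image g \<subseteq> T" "pathstart g = x" "pathfinish g = y"
    using seg_arc assms by metis
  note g = this
  show ?thesis
  proof
    assume "joined (T - {v}) x y"
    then obtain h where "arc h" "path_image h \<subseteq> T - {v}" "pathstart h = x" "pathfinish h = y"
      using False by (auto simp: joined_def)
    then show "v \<notin> seg x y" using seg_eq[of h x y] by auto
  next
    assume "v \<notin> seg x y"
    then show "joined (T - {v}) x y" using g assms unfolding joined_def by blast
  qed
qed (use assms in \<open>auto simp: joined_def\<close>)

lemma connected_component_minus_iff:
  assumes "x \<in> T" "y \<in> T" "x \<noteq> v" "y \<noteq> v"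
  shows "connected_component (T - {v}) x y \<longleftrightarrow> v \<notin> seg x y"
proof
  assume "connected_component (T - {v}) x y"
  then show "v \<notin> seg x y" using joined_if_connected[of "{v}"] joined_minus_iff assms by blast
next
  assume "v \<notin> seg x y"
  then show "connected_component (T - {v}) x y"
    using assms seg_connected seg_subset seg_ends unfolding connected_component_def
    by (metis subset_Diff_insert Diff_empty)
qed

text \<open>A point of the segment outside \<open>K\<close> would separate \<open>x\<close> from
  \<open>y\<close>, although \<open>K\<close> connects them.\<close>

lemma seg_subset_connected:
  assumes "connected K" "K \<subseteq> T" "x \<in> K" "y \<in> K"
  shows "seg x y \<subseteq> K"
proof
  fix v assume v: "v \<in> seg x y"
  show "v \<in> K"
  proof (rule ccontr)
    assume "v \<notin> K"
    then have "connected_component (T - {v}) x y"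
      using assms unfolding connected_component_def by blast
    then show False using connected_component_minus_iff[of x y v] assms v \<open>v \<notin> K\<close> by blast
  qed
qed

text \<open>The set is the component of \<open>T - {v}\<close> that contains
  \<open>q\<close>.\<close>

lemma openin_not_between:
  assumes "q \<in> T" "v \<in> T" "q \<noteq> v"
  shows "openin (top_of_set T) {w \<in> T. v \<notin> seg q w}"
proof -
  have "w \<in> T \<and> v \<notin> seg q w \<longleftrightarrow> joined (T - {v}) q w" for w
  proof (cases "w \<in> T \<and> w \<noteq> v")
    case True
    then show ?thesis using joined_minus_iff[OF assms(1) _ assms(3)] by auto
  next
    case False
    then show ?thesis using seg_ends(2)[OF assms(1,2)] by (auto simp: joined_def)
  qed
  then have "{w \<in> T. v \<notin> seg q w} = {w. joined (T - {v}) q w}" by auto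
  moreover have "openin (top_of_set T) (T - {v})"
    using openin_open_Int[of "- {v}" T] by (simp add: Diff_eq open_Compl)
  ultimately show ?thesis
    using openin_joined[of "{v}" v q] openin_trans by auto
qed

lemma seg_param:
  assumes "arc g" "path_image g \<subseteq> T" "a \<in> {0..1}" "b \<in> {0..1}"
  shows "seg (g a) (g b) = g ` closed_segment a b"
proof (cases "a = b")
  case False
  then show ?thesis
    using arc_subarc_unit[OF assms(1,3,4)] seg_eq[of "subarc a b g" "g a" "g b"] assms(2)
    by (simp add: path_image_subarc)
qed simp

lemma seg_split:
  assumes "x \<in> T" "y \<in> T" "v \<in> seg x y"
  shows "seg x v \<union> seg v y = seg x y" "seg x v \<inter> seg v y = {v}"
proof -
  have "seg x v \<union> seg v y = seg x y \<and> seg x v \<inter> seg v y = {v}"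
  proof (cases "x = y")
    case False
    then obtain g where g: "arc g" "path_image g = seg x y" "path_image g \<subseteq> T" "pathstart g = x" "pathfinish g = y"
      using seg_arc assms by metis
    then obtain t where t: "t \<in> {0..1}" "v = g t"
      using assms(3) unfolding g(2)[symmetric] path_image_def by blast
    have "seg x v = g ` {0..t}" "seg v y = g ` {t..1}"
      using seg_param[OF g(1,3), of 0 t] seg_param[OF g(1,3), of t 1] t g
      by (auto simp: pathstart_def pathfinish_def closed_segment_eq_real_ivl)
    moreover have "{0..t} \<union> {t..1} = {0..1}" "{0..t} \<inter> {t..1} = {t}" using t by auto
    moreover have "inj_on g {0..1}" using g by (simp add: arc_def)
    moreover have "g ` {0..t} \<inter> g ` {t..1} = g ` ({0..t} \<inter> {t..1})"
      using t(1) calculation(5) by (intro inj_on_image_Int[symmetric, of g "{0..1}"]) auto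
    ultimately show ?thesis
      using g(2) t(2) by (simp add: path_image_def image_Un[symmetric])
  qed (use assms in auto)
  then show "seg x v \<union> seg v y = seg x y" "seg x v \<inter> seg v y = {v}" by auto
qed

text \<open>Being joined in \<open>T - {v}\<close> is transitive: if \<open>v\<close> were on
  neither segment, it would not separate \<open>x\<close> from \<open>z\<close>.\<close>

lemma seg_triangle:
  assumes "x \<in> T" "y \<in> T" "z \<in> T" "v \<in> seg x z"
  shows "v \<in> seg x y \<or> v \<in> seg y z"
proof (rule ccontr)
  assume "\<not> ?thesis"
  moreover from this have ne: "x \<noteq> v" "y \<noteq> v" "z \<noteq> v"
    using seg_ends[OF assms(1,2)] seg_ends[OF assms(2,3)] by auto
  ultimately have "joined (T - {v}) x y" "joined (T - {v}) y z"
    using joined_minus_iff assms by auto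
  then have "joined (T - {v}) x z" by (rule joined_trans)
  then show False using joined_minus_iff[OF assms(1,3)] ne assms(4) by auto
qed

text \<open>The segment from \<open>x\<close> to \<open>y\<close> is connected and covered by the
  closed segments from \<open>z\<close> to its two ends, so these must meet on it.\<close>

lemma seg_median:
  assumes "x \<in> T" "y \<in> T" "z \<in> T"
  obtains m where "m \<in> T" "m \<in> seg x y" "m \<in> seg y z" "m \<in> seg x z"
proof -
  have "seg x y \<subseteq> seg x z \<union> seg z y" using seg_triangle[OF assms(1,3,2)] by auto
  moreover have "closed (seg x z)" "closed (seg z y)"
    using assms seg_compact compact_imp_closed by blast+
  moreover have "seg x z \<inter> seg x y \<noteq> {}" "seg z y \<inter> seg x y \<noteq> {}"
    using seg_ends(1)[OF assms(1,3)] seg_ends(1)[OF assms(1,2)]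
      seg_ends(2)[OF assms(3,2)] seg_ends(2)[OF assms(1,2)] by auto
  ultimately have "seg x z \<inter> seg z y \<inter> seg x y \<noteq> {}"
    using seg_connected[OF assms(1,2)] unfolding connected_closed by metis
  then show ?thesis using that seg_sym[OF assms(2,3)] seg_subset[OF assms(1,2)] by auto
qed

end

section \<open>Betweenness, directions at a point, cut points and branch points\<close>

context tree
begin

lemma seg_mono:
  assumes "x \<in> T" "y \<in> T" "v \<in> seg x y" "w \<in> seg x v"
  shows "w \<in> seg x y"
  using seg_split[OF assms(1,2,3)] assms(4) by blast

lemma seg_mono':
  assumes "x \<in> T" "y \<in> T" "v \<in> seg x y" "w \<in> seg v y"
  shows "w \<in> seg x y"
  using seg_split[OF assms(1,2,3)] assms(4) by blast

lemma seg_antisym: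
  assumes "x \<in> T" "v \<in> T" "w \<in> seg x v" "v \<in> seg x w"
  shows "v = w"
proof -
  have "w \<in> T" using assms seg_subset by blast
  then show ?thesis
    using seg_split(2)[OF assms(1,2,3)] assms(4) seg_ends(2)[of w v] assms(2) by blast
qed

lemma seg_order:
  assumes "x \<in> T" "y \<in> T" "v \<in> seg x y" "w \<in> seg x v"
  shows "v \<in> seg w y"
proof -
  have T: "v \<in> T" "w \<in> T" using assms seg_subset by blast+
  then have "v \<in> seg x w \<or> v \<in> seg w y" using seg_triangle[OF assms(1) _ assms(2,3)] by blast
  then show ?thesis using seg_antisym[OF assms(1) _ assms(4)] T seg_ends(1)[OF T(1) assms(2)] by auto
qed

lemma seg_linear:
  assumes "x \<in> T" "y \<in> T" "v \<in> seg x y" "w \<in> seg x y"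
  shows "v \<in> seg x w \<or> w \<in> seg x v"
proof -
  have T: "v \<in> T" "w \<in> T" using assms seg_subset by blast+
  have "w \<in> seg x v \<or> w \<in> seg v y" using seg_triangle[OF assms(1) T(1) assms(2,4)] .
  then show ?thesis
  proof
    assume "w \<in> seg v y"
    then have "w \<in> seg y v" using seg_sym T assms by blast
    moreover have "v \<in> seg y x" using assms seg_sym by blast
    ultimately have "v \<in> seg w x" using seg_order[of y x v w] assms by blast
    then show ?thesis using seg_sym T assms by blast
  qed simp
qed

text \<open>Points not separated by \<open>x\<close> lie in the same direction from it and may
  replace each other in statements about betweenness at \<open>x\<close>.\<close>

lemma seg_same_side:
  assumes "x \<in> T" "P \<in> T" "Q \<in> T" "Z \<in> T" "x \<notin> seg P Q"
  shows "x \<in> seg P Z \<longleftrightarrow> x \<in> seg Q Z"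
  using seg_triangle[of P Q Z x] seg_triangle[of Q P Z x] seg_sym[of P Q] assms by auto

lemma not_between_of_common:
  assumes "x \<in> T" "P \<in> T" "Q \<in> T" "m \<in> seg x P" "m \<in> seg x Q" "m \<noteq> x"
  shows "x \<notin> seg P Q"
proof
  assume "x \<in> seg P Q"
  then show False
    using seg_split(2)[of P Q x] assms seg_sym[of P x] by auto
qed

lemma not_between_of_mem:
  assumes "x \<in> T" "P \<in> T" "m \<in> seg x P" "m \<noteq> x"
  shows "x \<notin> seg m P"
  using not_between_of_common[of x m P m] assms seg_subset[OF assms(1,2)] seg_ends by blast

lemma common_of_not_between:
  assumes "x \<in> T" "P \<in> T" "Q \<in> T" "x \<notin> seg P Q"
  obtains m where "m \<in> T" "m \<in> seg x P" "m \<in> seg x Q" "m \<noteq> x" "m \<in> seg P Q"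
  using seg_median[of x P Q] assms by metis

definition cut_point :: "'a \<Rightarrow> bool" where
  "cut_point v \<longleftrightarrow> v \<in> T \<and> (\<exists>q r. q \<in> T \<and> r \<in> T \<and> q \<noteq> v \<and> r \<noteq> v \<and> v \<in> seg q r)"

definition branching :: "'a \<Rightarrow> bool" where
  "branching v \<longleftrightarrow> v \<in> T \<and> (\<exists>q r s. q \<in> T \<and> r \<in> T \<and> s \<in> T \<and> q \<noteq> v \<and> r \<noteq> v \<and> s \<noteq> v \<and>
     v \<in> seg q r \<and> v \<in> seg r s \<and> v \<in> seg q s)"

text \<open>The point \<open>q\<close> lies on one of finitely many arcs, which passes through
  \<open>v\<close> at most once; so one of the ends of this arc is reached from \<open>q\<close>
  without meeting \<open>v\<close>.\<close>

lemma finite_end_set: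
  obtains E where "finite E" "E \<subseteq> T"
    "\<And>v q. v \<in> T \<Longrightarrow> q \<in> T \<Longrightarrow> q \<noteq> v \<Longrightarrow> \<exists>e\<in>E. e \<noteq> v \<and> v \<notin> seg q e"
proof (cases rule: tree_cases)
  case (1 x)
  show ?thesis by (rule that[of "{}"]) (auto simp: 1)
next
  case (2 G)
  show ?thesis
  proof (rule that[of "pathstart ` G \<union> pathfinish ` G"])
    show "pathstart ` G \<union> pathfinish ` G \<subseteq> T"
      using 2(3) pathstart_in_path_image pathfinish_in_path_image by fast
    fix v q assume vq: "v \<in> T" "q \<in> T" "q \<noteq> v"
    then obtain g where g: "g \<in> G" "q \<in> path_image g" using 2(3) by blast
    then have ag: "arc g" "path_image g \<subseteq> T" using 2 by auto
    then have ig: "inj_on g {0..1}" by (simp add: arc_def)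
    obtain s where s: "s \<in> {0..1}" "q = g s" using g by (auto simp: path_image_def)
    have "\<exists>r\<in>{0,1}. v \<notin> g ` closed_segment s r"
    proof (rule ccontr)
      assume "\<not> ?thesis"
      then obtain a b where ab: "v = g a" "v = g b" "a \<in> closed_segment s 0" "b \<in> closed_segment s 1"
        by blast
      then have "a \<in> {0..s}" "b \<in> {s..1}"
        using s(1) by (auto simp: closed_segment_eq_real_ivl split: if_splits)
      moreover from this have "a = b" using ab ig s(1) by (auto simp: inj_on_def)
      ultimately have "a = s" by auto
      then show False using ab(1) s(2) vq(3) by simp
    qed
    then obtain r where r: "r \<in> {0,1}" "v \<notin> g ` closed_segment s r" by blast
    then have "g r \<noteq> v" by auto
    moreover have "v \<notin> seg q (g r)" using r s seg_param[OF ag s(1), of r] by auto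
    moreover have "g r \<in> pathstart ` G \<union> pathfinish ` G"
      using r(1) g(1) by (auto simp: pathstart_def pathfinish_def)
    ultimately show "\<exists>e\<in>pathstart ` G \<union> pathfinish ` G. e \<noteq> v \<and> v \<notin> seg q e" by blast
  qed (use 2 in auto)
qed

lemma median_unique:
  assumes T: "a \<in> T" "b \<in> T" "c \<in> T"
    and v: "v \<in> seg a b" "v \<in> seg b c" "v \<in> seg a c"
    and w: "w \<in> seg a b" "w \<in> seg b c" "w \<in> seg a c"
  shows "v = w"
proof -
  have vw: "v \<in> T" "w \<in> T" using v w seg_subset T by blast+
  have "w \<in> seg x v \<and> w \<in> seg v y \<Longrightarrow> v \<in> seg x y \<Longrightarrow> x \<in> T \<Longrightarrow> y \<in> T \<Longrightarrow> v = w" for x y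
    using seg_split(2)[of x y v] by auto
  note * = this
  have "w \<in> seg a v \<or> w \<in> seg v b" "w \<in> seg b v \<or> w \<in> seg v c" "w \<in> seg a v \<or> w \<in> seg v c"
    using seg_triangle w T vw by blast+
  then show ?thesis
    using *[of a b] *[of b c] *[of a c] v T vw seg_sym[of v] by auto
qed

text \<open>Every direction at a point contains a member of the finite set above, so a branch point
  is a median of three members, and three points have only one median.\<close>

lemma finite_branching: "finite {v. branching v}"
proof -
  obtain E where E: "finite E" "E \<subseteq> T"
    "\<And>v q. v \<in> T \<Longrightarrow> q \<in> T \<Longrightarrow> q \<noteq> v \<Longrightarrow> \<exists>e\<in>E. e \<noteq> v \<and> v \<notin> seg q e"
    using finite_end_set by blast
  let ?M = "\<lambda>(a, b, c). {v. v \<in> seg a b \<and> v \<in> seg b c \<and> v \<in> seg a c}"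
  have fin: "finite (?M t)" if "t \<in> E \<times> E \<times> E" for t
  proof -
    obtain a b c where "t = (a, b, c)" by (cases t)
    moreover from this have "a \<in> T" "b \<in> T" "c \<in> T" using that E(2) by auto
    ultimately have t: "t = (a, b, c)" "a \<in> T" "b \<in> T" "c \<in> T" by auto
    have "?M t \<subseteq> {v}" if "v \<in> ?M t" for v
      using median_unique[OF t(2-4)] that unfolding t(1) by auto
    then show ?thesis by (cases "?M t = {}") (auto dest: finite_subset)
  qed
  have "{v. branching v} \<subseteq> (\<Union>t\<in>E \<times> E \<times> E. ?M t)"
  proof
    fix v assume "v \<in> {v. branching v}"
    then obtain q r s where v: "v \<in> T" and q: "q \<in> T" "r \<in> T" "s \<in> T" "q \<noteq> v" "r \<noteq> v" "s \<noteq> v"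
      "v \<in> seg q r" "v \<in> seg r s" "v \<in> seg q s" by (auto simp: branching_def)
    obtain a where a: "a \<in> E" "v \<notin> seg q a" using E(3)[OF v q(1,4)] by auto
    obtain b where b: "b \<in> E" "v \<notin> seg r b" using E(3)[OF v q(2,5)] by auto
    obtain c where c: "c \<in> E" "v \<notin> seg s c" using E(3)[OF v q(3,6)] by auto
    note e = a b c
    then have abc: "a \<in> T" "b \<in> T" "c \<in> T" using E(2) by auto
    have *: "v \<in> seg x' y'" if "v \<in> seg x y" "v \<notin> seg x x'" "v \<notin> seg y y'"
      "x \<in> T" "y \<in> T" "x' \<in> T" "y' \<in> T" for x y x' y'
    proof -
      have "v \<in> seg y x'"
        using seg_same_side[OF v that(4,6,5,2)] that(1) seg_sym[OF that(5,6)] by simp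
      then show ?thesis
        using seg_same_side[OF v that(5,7,6,3)] seg_sym[OF that(6,7)] by simp
    qed
    have "v \<in> ?M (a, b, c)"
      using *[OF q(7) e(2,4) q(1,2) abc(1,2)] *[OF q(8) e(4,6) q(2,3) abc(2,3)]
        *[OF q(9) e(2,6) q(1,3) abc(1,3)] by simp
    moreover have "(a, b, c) \<in> E \<times> E \<times> E" using e by simp
    ultimately show "v \<in> (\<Union>t\<in>E \<times> E \<times> E. ?M t)" by (rule UN_I[rotated])
  qed
  moreover have "finite (\<Union>t\<in>E \<times> E \<times> E. ?M t)" using fin E(1) by (intro finite_UN_I) auto
  ultimately show ?thesis by (rule finite_subset)
qed

text \<open>The endpoint is a point of the finite set above that has the most points of this set
  between itself and a base point.\<close>

lemma exists_non_cut_endpoint: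
  assumes "x0 \<in> T" "x1 \<in> T" "x0 \<noteq> x1"
  obtains e where "e \<in> endpoints T" "\<not> cut_point e"
proof -
  obtain E where E: "finite E" "E \<subseteq> T"
    "\<And>v q. v \<in> T \<Longrightarrow> q \<in> T \<Longrightarrow> q \<noteq> v \<Longrightarrow> \<exists>e\<in>E. e \<noteq> v \<and> v \<notin> seg q e"
    using finite_end_set by blast
  have "E - {x0} \<noteq> {}" using E(3)[OF assms(1,2)] assms(3) by blast
  define N where "N e = card {d \<in> E. d \<in> seg x0 e}" for e
  obtain e where "e \<in> E - {x0}" and Me: "N e = Max (N ` (E - {x0}))"
    using obtains_MAX[of "E - {x0}" N] \<open>E - {x0} \<noteq> {}\<close> E(1) by (metis finite_Diff)
  moreover have "N d \<le> N e" if "d \<in> E - {x0}" for d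
    unfolding Me using E(1) that by (intro Max_ge) auto
  ultimately have e: "e \<in> E - {x0}" "\<And>d. d \<in> E - {x0} \<Longrightarrow> N d \<le> N e" by blast+
  have eT: "e \<in> T" "e \<noteq> x0" using e(1) E(2) by auto
  \<comment> \<open>A point of \<open>E\<close> beyond \<open>e\<close> would have more points of
    \<open>E\<close> before it than \<open>e\<close> has.\<close>
  have far: "d = e" if "d \<in> E" "e \<in> seg x0 d" for d
  proof (rule ccontr)
    assume "d \<noteq> e"
    have dT: "d \<in> T" "d \<noteq> x0" using that E(2) eT by auto
    have "d \<notin> seg x0 e" using seg_antisym[OF assms(1) dT(1) that(2)] \<open>d \<noteq> e\<close> by auto
    then have "d \<in> {c \<in> E. c \<in> seg x0 d} - {c \<in> E. c \<in> seg x0 e}"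
      using seg_ends(2)[OF assms(1) dT(1)] that(1) by simp
    moreover have "{c \<in> E. c \<in> seg x0 e} \<subseteq> {c \<in> E. c \<in> seg x0 d}"
      using seg_mono[OF assms(1) dT(1) that(2)] by (rule_tac Collect_mono) simp
    ultimately have "{c \<in> E. c \<in> seg x0 e} \<subset> {c \<in> E. c \<in> seg x0 d}" by blast
    then have "N e < N d" unfolding N_def using E(1) by (simp add: psubset_card_mono)
    then show False using e(2)[of d] that(1) dT by auto
  qed
  have side: "e \<notin> seg x0 q" if "q \<in> T" "q \<noteq> e" for q
  proof
    assume "e \<in> seg x0 q"
    obtain d where d: "d \<in> E" "d \<noteq> e" "e \<notin> seg q d"
      using E(3)[OF eT(1) \<open>q \<in> T\<close> \<open>q \<noteq> e\<close>] by auto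
    then have dT: "d \<in> T" using E(2) by auto
    have "e \<in> seg x0 d"
      using seg_same_side[OF eT(1) \<open>q \<in> T\<close> dT assms(1) d(3)] \<open>e \<in> seg x0 q\<close>
        seg_sym[OF assms(1) \<open>q \<in> T\<close>] seg_sym[OF assms(1) dT] by simp
    then show False using far[OF d(1)] d(2) by simp
  qed
  have nc: "\<not> cut_point e"
  proof
    assume "cut_point e"
    then obtain q r where qr: "q \<in> T" "r \<in> T" "q \<noteq> e" "r \<noteq> e" "e \<in> seg q r"
      by (auto simp: cut_point_def)
    show False
      using seg_triangle[OF qr(1) assms(1) qr(2,5)] side[OF qr(1,3)] side[OF qr(2,4)]
        seg_sym[OF qr(1) assms(1)] by simp
  qed
  have "T - {e} \<noteq> {}" using assms(1) eT by auto
  moreover have "connected_component (T - {e}) q r" if "q \<in> T - {e}" "r \<in> T - {e}" for q r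
  proof -
    have "e \<notin> seg q r" using that nc eT(1) by (auto simp: cut_point_def)
    then show ?thesis using connected_component_minus_iff[of q r e] that by simp
  qed
  then have "connected (T - {e})" by (simp add: connected_iff_connected_component)
  ultimately have "components (T - {e}) = {T - {e}}" by (simp add: components_eq_sing_iff)
  then have "e \<in> endpoints T" using eT by (simp add: endpoints_def)
  then show ?thesis using nc that by blast
qed

end

section \<open>Images of arcs\<close>

text \<open>If two points of an arc had the same image, a pair of them at minimal parameter distance
  would bound a simple closed curve.\<close>

lemma (in tree) inj_on_locally_inj_path:
  assumes cont: "continuous_on {0..1} p" and pT: "p ` {0..1} \<subseteq> T"
    and loc: "\<And>t. 0 < t \<Longrightarrow> t < 1 \<Longrightarrow> \<exists>e>0. inj_on p ({0..1} \<inter> ball t e)"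
    and loc0: "\<exists>e>0. inj_on p ({0..1} \<inter> ball 0 e)"
  shows "inj_on p {0..1::real}"
proof -
  have loop: False
    if "0 \<le> a" "a < b" "b \<le> 1" "p a = p b"
      and *: "\<And>s t. a \<le> s \<Longrightarrow> s < t \<Longrightarrow> t \<le> b \<Longrightarrow> p s = p t \<Longrightarrow> s = a \<and> t = b" for a b
  proof -
    have "continuous_on {a..b} p" using cont that by (auto intro: continuous_on_subset)
    then have "simple_path (subarc a b p)" using injective_loop[of a b p] that by blast
    moreover have "path_image (subarc a b p) \<subseteq> T"
      using pT that by (auto simp: path_image_subarc closed_segment_eq_real_ivl)
    ultimately show False using no_loop[of "subarc a b p"] that(4) by simp
  qed
  have inj: "p a \<noteq> p b" if "0 \<le> a" "a < b" "b < 1" for a b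
  proof
    assume eq: "p a = p b"
    have "\<exists>e>0. inj_on p ({0..1} \<inter> ball t e)" if "t \<in> {0..b}" for t
      using loc[of t] loc0 that \<open>b < 1\<close> by (cases "t = 0") auto
    then obtain e where e: "\<And>t. t \<in> {0..b} \<Longrightarrow> 0 < e t \<and> inj_on p ({0..1} \<inter> ball t (e t))"
      by metis
    \<comment> \<open>\<open>d\<close> is a Lebesgue number of a cover by intervals of injectivity:
      distinct parameters with equal images are at least \<open>d\<close> apart, which makes the set
      \<open>Z\<close> of such pairs closed.\<close>
    obtain d where d: "d > 0" "\<And>t. t \<in> {0..b} \<Longrightarrow> \<exists>G\<in>(\<lambda>t. ball t (e t)) ` {0..b}. ball t d \<subseteq> G"
    proof -
      have "{0..b} \<subseteq> \<Union>((\<lambda>t. ball t (e t)) ` {0..b})" using e by force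
      then show ?thesis using Heine_Borel_lemma[of "{0..b}" "(\<lambda>t. ball t (e t)) ` {0..b}"] that by auto
    qed
    have close: "s = t" if "s \<in> {0..b}" "t \<in> {0..b}" "dist s t < d" "p s = p t" for s t
    proof -
      obtain r where r: "r \<in> {0..b}" "ball s d \<subseteq> ball r (e r)" using d(2) \<open>s \<in> {0..b}\<close> by blast
      moreover have "s \<in> ball s d" "t \<in> ball s d" using that(3) d(1) by auto
      ultimately have "s \<in> ball r (e r)" "t \<in> ball r (e r)" by blast+
      then show ?thesis using e[OF r(1)] that \<open>b < 1\<close> by (auto simp: inj_on_def)
    qed
    define Z where "Z = {x \<in> {0..b} \<times> {0..b}. p (fst x) = p (snd x) \<and> fst x + d \<le> snd x}"
    have "continuous_on ({0..b} \<times> {0..b}) (\<lambda>x. dist (p (fst x)) (p (snd x)))"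
      using cont \<open>b < 1\<close>
      by (intro continuous_on_dist continuous_on_compose2[OF cont] continuous_intros) auto
    then have "closed ({0..b} \<times> {0..b} \<inter> (\<lambda>x. dist (p (fst x)) (p (snd x))) -` {0})"
      by (intro continuous_closed_preimage closed_Times) auto
    moreover have "closed {x :: real \<times> real. fst x + d \<le> snd x}"
      by (intro closed_Collect_le continuous_intros)
    moreover have "Z = ({0..b} \<times> {0..b} \<inter> (\<lambda>x. dist (p (fst x)) (p (snd x))) -` {0})
        \<inter> {x. fst x + d \<le> snd x}" by (auto simp: Z_def)
    ultimately have "closed Z" by (simp add: closed_Int)
    moreover have "bounded Z"
      by (rule bounded_subset[of "{0..b} \<times> {0..b}"]) (auto simp: Z_def bounded_Times)
    ultimately have "compact Z" by (simp add: compact_eq_bounded_closed)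
    moreover have "(a, b) \<in> Z"
      using close[of a b] eq that by (force simp: Z_def dist_real_def)
    moreover have "continuous_on Z (\<lambda>x. snd x - fst x)" by (intro continuous_intros)
    ultimately have "\<exists>x\<in>Z. \<forall>y\<in>Z. snd x - fst x \<le> snd y - fst y"
      using continuous_attains_inf[of Z "\<lambda>x. snd x - fst x"] by blast
    then obtain x where x: "x \<in> Z" "\<And>y. y \<in> Z \<Longrightarrow> snd x - fst x \<le> snd y - fst y" by blast
    show False
    proof (rule loop[of "fst x" "snd x"])
      show "s = fst x \<and> t = snd x" if "fst x \<le> s" "s < t" "t \<le> snd x" "p s = p t" for s t
      proof -
        have "s \<in> {0..b}" "t \<in> {0..b}" using that x(1) by (auto simp: Z_def)
        moreover from this have "s + d \<le> t" using close[of s t] that by (force simp: dist_real_def)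
        ultimately have "(s, t) \<in> Z" using that by (auto simp: Z_def)
        then show ?thesis using x(2)[of "(s, t)"] that by auto
      qed
    qed (use x(1) d(1) \<open>b < 1\<close> in \<open>auto simp: Z_def\<close>)
  qed
  \<comment> \<open>Nothing is assumed near the parameter \<open>1\<close>. Given injectivity before
    it, a coincidence with \<open>p 1\<close> bounds a simple closed curve at once.\<close>
  moreover have "p a \<noteq> p 1" if "0 \<le> a" "a < 1" for a
  proof
    assume "p a = p 1"
    show False
    proof (rule loop[of a 1])
      show "s = a \<and> t = 1" if st: "a \<le> s" "s < t" "t \<le> 1" "p s = p t" for s t
        using inj[of s t] inj[of a s] st \<open>p a = p 1\<close> \<open>0 \<le> a\<close>
        by (cases "t = 1"; cases "s = a") auto
    qed (use that \<open>p a = p 1\<close> in auto)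
  qed
  ultimately have *: "p a \<noteq> p b" if "0 \<le> a" "a < b" "b \<le> 1" for a b
    using that by (cases "b = 1") auto
  show ?thesis
    by (rule linorder_inj_onI) (use * in auto)
qed

section \<open>Hubbard trees\<close>

lemma is_periodic_iff: "is_periodic f x \<longleftrightarrow> (\<exists>n>0. (f ^^ n) x = x)"
proof
  assume "\<exists>n>0. (f ^^ n) x = x"
  then obtain n where "n > 0 \<and> (f ^^ n) x = x" by blast
  then have "has_period f x (LEAST n. n > 0 \<and> (f ^^ n) x = x)"
    unfolding has_period_def by (metis (mono_tags, lifting) LeastI not_less_Least)
  then show "is_periodic f x" by (auto simp: is_periodic_def)
qed (auto simp: is_periodic_def has_period_def)

lemma is_periodic_funpow: "is_periodic f x \<Longrightarrow> is_periodic f ((f ^^ k) x)"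
  unfolding is_periodic_iff by (metis funpow_add add.commute comp_apply)

definition eventually_periodic :: "('a \<Rightarrow> 'a) \<Rightarrow> 'a \<Rightarrow> bool" where
  "eventually_periodic f x \<longleftrightarrow> (\<exists>t. is_periodic f ((f ^^ t) x))"

lemma eventually_periodicI:
  assumes "(f ^^ i) x = (f ^^ j) x" "i < j"
  shows "eventually_periodic f x"
proof -
  have "(f ^^ (j - i)) ((f ^^ i) x) = (f ^^ i) x"
    using assms by (metis funpow_add comp_apply le_add_diff_inverse2 less_imp_le)
  then show ?thesis
    unfolding eventually_periodic_def is_periodic_iff using assms(2) zero_less_diff by blast
qed

lemma eventually_periodic_finite_orbit:
  assumes "finite A" "\<And>t. (f ^^ t) x \<in> A"
  shows "eventually_periodic f x"
proof -
  have "\<not> inj (\<lambda>t. (f ^^ t) x)"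
    using assms finite_subset[of "range (\<lambda>t. (f ^^ t) x)" A] finite_imageD by blast
  then obtain i j where "i \<noteq> j" "(f ^^ i) x = (f ^^ j) x" by (auto simp: inj_def)
  then show ?thesis
    using eventually_periodicI[of i f x j] eventually_periodicI[of j f x i] by (cases "i < j") auto
qed

lemma eventually_periodic_funpow:
  assumes "eventually_periodic f x"
  shows "eventually_periodic f ((f ^^ t) x)"
proof -
  obtain s where "is_periodic f ((f ^^ s) x)" using assms by (auto simp: eventually_periodic_def)
  then have "is_periodic f ((f ^^ t) ((f ^^ s) x))" by (rule is_periodic_funpow)
  moreover have "(f ^^ t) ((f ^^ s) x) = (f ^^ s) ((f ^^ t) x)"
    by (metis add.commute comp_apply funpow_add)
  ultimately show ?thesis by (auto simp: eventually_periodic_def)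
qed

text \<open>The second assumption follows from the existence of a characteristic point, by
  \<open>hub_characteristicI\<close>.\<close>

locale hub =
  fixes T :: "'a::metric_space set" and f :: "'a \<Rightarrow> 'a" and c0 :: 'a
  assumes minimal: "minimal_hubbard_tree T f c0"
    and c1_ne: "f c0 \<noteq> c0"
begin

lemma hubbard: "hubbard_tree T f c0"
  using minimal by (simp add: minimal_hubbard_tree_def)

sublocale tree T
  using hubbard by unfold_locales (simp add: hubbard_tree_def)

lemma cont: "continuous_on T f"
  using hubbard by (simp add: hubbard_tree_def)

lemma c0_in [simp]: "c0 \<in> T"
  using hubbard by (simp add: hubbard_tree_def)

lemma f_in [simp]: "x \<in> T \<Longrightarrow> f x \<in> T"
  using hubbard by (auto simp: hubbard_tree_def)

lemma iter_in [simp]: "x \<in> T \<Longrightarrow> (f ^^ n) x \<in> T"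
  by (induction n) auto

lemma f_locally_inj:
  assumes "x \<in> T" "x \<noteq> c0"
  obtains U where "openin (top_of_set T) U" "x \<in> U" "inj_on f U"
  using hubbard assms unfolding hubbard_tree_def by (metis Diff_iff singletonD)

lemma inj_on_seg_aux:
  assumes xy: "x \<in> T" "y \<in> T" "x \<noteq> y" "c0 \<in> seg x y \<Longrightarrow> c0 = y"
  obtains g where "arc g" "path_image g = seg x y" "pathstart g = x" "pathfinish g = y"
    "inj_on (f \<circ> g) {0..1}"
proof -
  obtain g where g: "arc g" "path_image g = seg x y" "path_image g \<subseteq> T" "pathstart g = x" "pathfinish g = y"
    using seg_arc xy by metis
  have cg: "continuous_on {0..1} g" and ig: "inj_on g {0..1}" using g by (auto simp: arc_def path_def)
  have im: "g ` {0..1} \<subseteq> T" using g by (simp add: path_image_def)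
  have loc: "\<exists>e>0. inj_on (f \<circ> g) ({0..1} \<inter> ball t e)" if t: "0 \<le> t" "t < 1" for t
  proof -
    have t01: "t \<in> {0..1}" using t by auto
    then have gt: "g t \<in> T" "g t \<in> seg x y" using im g(2) by (auto simp: path_image_def)
    have "g t \<noteq> g 1" using ig t inj_onD[OF ig, of t 1] by auto
    then have "g t \<noteq> c0" using xy(4) gt(2) g(5) by (auto simp: pathfinish_def)
    then obtain U where U: "openin (top_of_set T) U" "g t \<in> U" "inj_on f U"
      using f_locally_inj gt(1) by blast
    then obtain e where e: "e > 0" "ball (g t) e \<inter> T \<subseteq> U"
      by (auto simp: openin_contains_ball)
    obtain d where d: "d > 0" "\<And>s. s \<in> {0..1} \<Longrightarrow> dist s t < d \<Longrightarrow> dist (g s) (g t) < e"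
      using cg t01 e(1) unfolding continuous_on_iff by blast
    have "g s \<in> U" if "s \<in> {0..1} \<inter> ball t d" for s
    proof -
      have "g s \<in> ball (g t) e" using d(2)[of s] that by (simp add: dist_commute)
      then show ?thesis using that e(2) im by blast
    qed
    then have "inj_on f (g ` ({0..1} \<inter> ball t d))"
      using U(3) by (auto intro: inj_on_subset)
    moreover have "inj_on g ({0..1} \<inter> ball t d)" using ig by (rule inj_on_subset) auto
    ultimately have "inj_on (f \<circ> g) ({0..1} \<inter> ball t d)" by (rule comp_inj_on[rotated])
    then show ?thesis using d(1) by blast
  qed
  have "inj_on (f \<circ> g) {0..1}"
  proof (rule inj_on_locally_inj_path)
    show "continuous_on {0..1} (f \<circ> g)"
      using cg cont im by (metis continuous_on_compose continuous_on_subset)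
    show "(f \<circ> g) ` {0..1} \<subseteq> T" using im by auto
  qed (use loc in auto)
  then show ?thesis using that g by blast
qed

lemma inj_seg:
  assumes "x \<in> T" "y \<in> T" "c0 \<in> seg x y \<Longrightarrow> c0 = x \<or> c0 = y"
  shows "inj_on f (seg x y)" "f ` seg x y = seg (f x) (f y)"
proof -
  have main: "inj_on f (seg x y) \<and> f ` seg x y = seg (f x) (f y)"
    if xy: "x \<in> T" "y \<in> T" "x \<noteq> y" "c0 \<in> seg x y \<Longrightarrow> c0 = y" for x y
  proof -
    obtain g where g: "arc g" "path_image g = seg x y" "pathstart g = x" "pathfinish g = y"
      "inj_on (f \<circ> g) {0..1}" using inj_on_seg_aux xy by blast
    have im: "g ` {0..1} = seg x y" using g(2) by (simp add: path_image_def)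
    have "seg x y \<subseteq> T" using seg_subset xy by blast
    then have "continuous_on {0..1} (f \<circ> g)"
      using g(1) cont im by (metis arc_def continuous_on_compose continuous_on_subset path_def)
    then have "arc (f \<circ> g)" using g(5) by (simp add: arc_def path_def)
    moreover have pim: "path_image (f \<circ> g) = f ` seg x y" by (simp add: path_image_def im[symmetric] image_image)
    moreover have "f ` seg x y \<subseteq> T" using \<open>seg x y \<subseteq> T\<close> by auto
    ultimately have "seg (f x) (f y) = f ` seg x y"
      using seg_eq[of "f \<circ> g" "f x" "f y"] g(3,4) by (simp add: pathstart_def pathfinish_def)
    moreover have "inj_on f (seg x y)" using inj_on_imageI[OF g(5)] im by simp
    ultimately show ?thesis by simp
  qed
  have "inj_on f (seg x y) \<and> f ` seg x y = seg (f x) (f y)"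
  proof (cases "x = y")
    case False
    show ?thesis
    proof (cases "c0 = x")
      case True
      then show ?thesis
        using main[of y x] False assms(1,2) seg_sym[OF assms(1,2)] seg_sym[of "f x" "f y"] by auto
    next
      case False
      then show ?thesis using main[of x y] assms \<open>x \<noteq> y\<close> by blast
    qed
  qed simp
  then show "inj_on f (seg x y)" "f ` seg x y = seg (f x) (f y)" by auto
qed

text \<open>Stopping at \<open>c0\<close> keeps \<open>f\<close> injective on the segment from
  \<open>x\<close>, so that the direction at \<open>x\<close> towards \<open>P\<close> has an image
  direction at \<open>f x\<close>.\<close>

definition trim :: "'a \<Rightarrow> 'a \<Rightarrow> 'a" where
  "trim x P = (if c0 \<in> seg x P then c0 else P)"

lemma trim_in [simp]: "x \<in> T \<Longrightarrow> P \<in> T \<Longrightarrow> trim x P \<in> T"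
  by (simp add: trim_def)

lemma trim_in_seg: "x \<in> T \<Longrightarrow> P \<in> T \<Longrightarrow> trim x P \<in> seg x P"
  by (simp add: trim_def seg_ends)

lemma trim_ne: "x \<noteq> c0 \<Longrightarrow> P \<noteq> x \<Longrightarrow> trim x P \<noteq> x"
  by (auto simp: trim_def)

lemma trim_seg: "c0 \<in> seg x (trim x P) \<Longrightarrow> c0 = trim x P"
  by (auto simp: trim_def split: if_splits)

lemma inj_trim: 
  assumes "x \<in> T" "P \<in> T"
  shows "inj_on f (seg x (trim x P))" "f ` seg x (trim x P) = seg (f x) (f (trim x P))"
  using inj_seg[of x "trim x P"] trim_seg assms by auto

lemma f_trim_ne: 
  assumes "x \<in> T" "P \<in> T" "x \<noteq> c0" "P \<noteq> x"
  shows "f (trim x P) \<noteq> f x"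
proof
  assume "f (trim x P) = f x"
  then have "trim x P = x"
    using inj_onD[OF inj_trim(1)[OF assms(1,2)], of "trim x P" x] seg_ends[of x "trim x P"] assms by auto
  then show False using trim_ne assms by blast
qed

text \<open>This is the action of \<open>f\<close> on the directions at a point \<open>x\<close>: those towards \<open>P\<close> and \<open>Z\<close> are
  distinct if and only if their images at \<open>f x\<close> are.\<close>

lemma between_image_iff:
  assumes "x \<in> T" "P \<in> T" "Z \<in> T" "x \<noteq> c0"
  shows "x \<in> seg P Z \<longleftrightarrow> f x \<in> seg (f (trim x P)) (f (trim x Z))"
proof (cases "P = x \<or> Z = x")
  case True
  have "trim x x = x" using assms(4) by (auto simp: trim_def)
  then have "x \<in> seg P Z" "f x \<in> seg (f (trim x P)) (f (trim x Z))"
    using True seg_ends assms by auto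
  then show ?thesis by simp
next
  case False
  let ?P = "trim x P" and ?Z = "trim x Z"
  have T: "?P \<in> T" "?Z \<in> T" using assms by auto
  have "x \<notin> seg ?P P" "x \<notin> seg ?Z Z"
    using not_between_of_mem trim_in_seg trim_ne assms False by auto
  then have *: "x \<in> seg P Z \<longleftrightarrow> x \<in> seg ?P ?Z"
    using seg_same_side[of x ?P P Z] seg_same_side[of x ?Z Z ?P] seg_sym[of ?P] T assms by auto
  show ?thesis
  proof (cases "x \<in> seg ?P ?Z")
    case True
    have "c0 = ?P \<or> c0 = ?Z" if "c0 \<in> seg ?P ?Z"
    proof -
      have "c0 \<in> seg x ?P \<or> c0 \<in> seg x ?Z"
        using seg_split(1)[OF T True] that seg_sym[OF assms(1) T(1)] by blast
      then show ?thesis using trim_seg by blast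
    qed
    then have "f ` seg ?P ?Z = seg (f ?P) (f ?Z)" using inj_seg(2) T by blast
    then show ?thesis using * True by blast
  next
    case False
    then obtain m where m: "m \<in> T" "m \<in> seg x ?P" "m \<in> seg x ?Z" "m \<noteq> x"
      using common_of_not_between[of x ?P ?Z] T assms by metis
    then have "f m \<in> seg (f x) (f ?P)" "f m \<in> seg (f x) (f ?Z)"
      using inj_trim(2) assms by blast+
    moreover have "f m \<noteq> f x"
      using inj_onD[OF inj_trim(1)[OF assms(1,2)], of m x] m seg_ends(1)[OF assms(1) T(1)] by auto
    ultimately have "f x \<notin> seg (f ?P) (f ?Z)"
      using not_between_of_common[of "f x" "f ?P" "f ?Z" "f m"] assms T by auto
    then show ?thesis using * False by simp
  qed
qed

lemma cut_point_image:
  assumes "cut_point v" "v \<noteq> c0"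
  shows "cut_point (f v)"
proof -
  obtain q r where qr: "v \<in> T" "q \<in> T" "r \<in> T" "q \<noteq> v" "r \<noteq> v" "v \<in> seg q r"
    using assms by (auto simp: cut_point_def)
  have "f v \<in> seg (f (trim v q)) (f (trim v r))" using between_image_iff qr assms by blast
  then show ?thesis
    unfolding cut_point_def using qr f_trim_ne assms(2) by (metis f_in trim_in)
qed

lemma branching_image:
  assumes "branching v" "v \<noteq> c0"
  shows "branching (f v)"
proof -
  obtain q r s where q: "v \<in> T" "q \<in> T" "r \<in> T" "s \<in> T" "q \<noteq> v" "r \<noteq> v" "s \<noteq> v"
     "v \<in> seg q r" "v \<in> seg r s" "v \<in> seg q s"
    using assms by (auto simp: branching_def)
  let ?q = "f (trim v q)" and ?r = "f (trim v r)" and ?s = "f (trim v s)"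
  have "f v \<in> seg ?q ?r" "f v \<in> seg ?r ?s" "f v \<in> seg ?q ?s"
    using between_image_iff q assms(2) by blast+
  moreover have "?q \<noteq> f v" "?r \<noteq> f v" "?s \<noteq> f v" using f_trim_ne q assms(2) by blast+
  moreover have "?q \<in> T" "?r \<in> T" "?s \<in> T" using q by auto
  ultimately show ?thesis unfolding branching_def using q(1) f_in by blast
qed

text \<open>Away from \<open>c0\<close> branch points are mapped to branch points, and there are
  only finitely many of them.\<close>

lemma branching_eventually_periodic:
  assumes "branching v" "\<And>t. (f ^^ t) v \<noteq> c0"
  shows "eventually_periodic f v"
proof (rule eventually_periodic_finite_orbit[OF finite_branching])
  show "(f ^^ t) v \<in> {v. branching v}" for t
    by (induction t) (use assms branching_image in auto)
qed

lemma cut_point_orbit: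
  assumes "cut_point c0" "cut_point (f c0)"
  shows "cut_point ((f ^^ t) c0)"
  by (induction t) (use assms cut_point_image in fastforce)+

text \<open>Three directions at \<open>c0\<close> would have at least two distinct images at the critical value, since
  \<open>f\<close> is at most 2-to-1. Then no point of the critical orbit would be an endpoint.\<close>

lemma two_sides:
  assumes q: "q \<in> T" "r \<in> T" "s \<in> T" "q \<noteq> c0" "r \<noteq> c0" "s \<noteq> c0"
  shows "\<not> (c0 \<in> seg q r \<and> c0 \<in> seg r s \<and> c0 \<in> seg q s)"
proof
  assume sep: "c0 \<in> seg q r \<and> c0 \<in> seg r s \<and> c0 \<in> seg q s"
  have im: "f ` seg c0 a = seg (f c0) (f a)" if "a \<in> T" for a using inj_seg(2)[of c0 a] that by auto
  have ne: "f a \<noteq> f c0" if "a \<in> T" "a \<noteq> c0" for a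
    using inj_onD[OF inj_seg(1)[of c0 a], of a c0] that seg_ends[of c0 a] by auto
  have dis: "seg c0 a \<inter> seg c0 b = {c0}" if "c0 \<in> seg a b" "a \<in> T" "b \<in> T" for a b
    using seg_split(2)[OF that(2,3,1)] seg_sym[of a c0] that by auto
  have "f c0 \<in> seg (f q) (f r) \<or> f c0 \<in> seg (f q) (f s) \<or> f c0 \<in> seg (f r) (f s)"
  proof (rule ccontr)
    assume none: "\<not> ?thesis"
    obtain m where m: "m \<in> T" "m \<in> seg (f c0) (f q)" "m \<in> seg (f c0) (f r)" "m \<noteq> f c0"
      using common_of_not_between[of "f c0" "f q" "f r"] q none by auto
    obtain n where n: "n \<in> T" "n \<in> seg (f c0) (f q)" "n \<in> seg (f c0) (f s)" "n \<noteq> f c0"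
      using common_of_not_between[of "f c0" "f q" "f s"] q none by auto
    \<comment> \<open>Whichever of \<open>m\<close> and \<open>n\<close> is nearer to the critical
      value lies on all three image segments, and so has a preimage in each of the three directions
      at \<open>c0\<close>.\<close>
    have "m \<in> seg (f c0) n \<or> n \<in> seg (f c0) m"
      using seg_linear[of "f c0" "f q" m n] q m n by auto
    then obtain w where w: "w \<in> seg (f c0) (f q)" "w \<in> seg (f c0) (f r)" "w \<in> seg (f c0) (f s)" "w \<noteq> f c0"
      using m n q seg_mono[of "f c0" "f s" n m] seg_mono[of "f c0" "f r" m n] by auto
    have "w \<in> f ` seg c0 q" "w \<in> f ` seg c0 r" "w \<in> f ` seg c0 s"
      using w(1-3) im q(1-3) by auto
    then obtain x y z where x: "x \<in> seg c0 q" "f x = w" and y: "y \<in> seg c0 r" "f y = w"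
      and z: "z \<in> seg c0 s" "f z = w"
      by (elim imageE) simp
    have "x \<noteq> c0" "y \<noteq> c0" "z \<noteq> c0" using x y z w(4) by auto
    then have "x \<noteq> y" "y \<noteq> z" "x \<noteq> z"
      using dis[of q r] dis[of r s] dis[of q s] sep q x y z by auto
    then have "card {x, y, z} = 3" by simp
    moreover have "w \<in> T" using w(1) seg_subset q by (meson c0_in f_in in_mono)
    then have "finite {x \<in> T. f x = w}" "card {x \<in> T. f x = w} \<le> 2"
      using hubbard by (auto simp: hubbard_tree_def)
    moreover have "{x, y, z} \<subseteq> {x \<in> T. f x = w}"
      using x y z seg_subset[OF c0_in q(1)] seg_subset[OF c0_in q(2)] seg_subset[OF c0_in q(3)] by auto
    ultimately show False using card_mono[of "{x \<in> T. f x = w}" "{x, y, z}"] by linarith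
  qed
  then have "cut_point (f c0)" unfolding cut_point_def using ne q c0_in f_in by metis
  moreover have "cut_point c0" unfolding cut_point_def using sep q c0_in by metis
  moreover obtain e where "e \<in> endpoints T" "\<not> cut_point e"
    using exists_non_cut_endpoint[of c0 "f c0"] c1_ne c0_in f_in by metis
  moreover have "endpoints T \<subseteq> orb f c0" using hubbard by (simp add: hubbard_tree_def)
  ultimately show False using cut_point_orbit by (auto simp: orb_def)
qed

section \<open>Itineraries and separation by the critical point\<close>

abbreviation itin :: "'a \<Rightarrow> nat \<Rightarrow> symbol" where
  "itin \<equiv> itinerary T f c0"

lemma itin_funpow: "itin ((f ^^ k) x) i = itin x (k + i)"
proof -
  have "(f ^^ i) ((f ^^ k) x) = (f ^^ (k + i)) x" by (metis funpow_add add.commute comp_apply)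
  then show ?thesis by (simp add: itinerary_def)
qed

lemma itin_Star_iff: "itin x i = Star \<longleftrightarrow> (f ^^ i) x = c0"
  by (simp add: itinerary_def)

text \<open>By \<open>two_sides\<close> there are at most two sides of \<open>c0\<close>, so two
  points are on the same side exactly when both or neither are separated from the critical
  value.\<close>

lemma itin_eq_iff:
  assumes "x \<in> T" "y \<in> T" "(f ^^ i) x \<noteq> c0" "(f ^^ j) y \<noteq> c0"
  shows "itin x i = itin y j \<longleftrightarrow> c0 \<notin> seg ((f ^^ i) x) ((f ^^ j) y)"
proof -
  let ?x = "(f ^^ i) x" and ?y = "(f ^^ j) y"
  have T: "?x \<in> T" "?y \<in> T" using assms by auto
  have "?x \<in> T1_part T f c0 \<longleftrightarrow> c0 \<notin> seg (f c0) ?x" "?y \<in> T1_part T f c0 \<longleftrightarrow> c0 \<notin> seg (f c0) ?y"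
    using connected_component_minus_iff[of "f c0" ?x c0] connected_component_minus_iff[of "f c0" ?y c0]
      T assms(3,4) c1_ne by (auto simp: T1_part_def)
  then have "itin x i = itin y j \<longleftrightarrow> (c0 \<in> seg (f c0) ?x \<longleftrightarrow> c0 \<in> seg (f c0) ?y)"
    using assms(3,4) by (auto simp: itinerary_def)
  also have "\<dots> \<longleftrightarrow> c0 \<notin> seg ?x ?y"
    using two_sides[of "f c0" ?x ?y] seg_same_side[of c0 "f c0" ?x ?y]
      seg_triangle[of ?x "f c0" ?y c0] seg_triangle[of "f c0" ?x ?y c0] seg_triangle[of "f c0" ?y ?x c0]
      seg_sym[of ?x "f c0"] seg_sym[of ?x ?y] T assms(3,4) c1_ne by auto
  finally show ?thesis .
qed

text \<open>Whether a direction is cut at \<open>c0\<close> can be read off the symbols; this makes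
  the action on directions computable from itineraries.\<close>

lemma trim_itin:
  assumes "x \<in> T" "y \<in> T" "(f ^^ i) x \<noteq> c0"
  shows "trim ((f ^^ i) x) ((f ^^ j) y) = (if itin y j = itin x i then (f ^^ j) y else c0)"
proof (cases "(f ^^ j) y = c0")
  case True
  then show ?thesis by (simp add: trim_def)
next
  case False
  then show ?thesis using itin_eq_iff[OF assms(1,2,3) False] by (auto simp: trim_def)
qed

lemma same_itin_seg:
  assumes "x \<in> T" "m \<in> T" "\<And>t. (f ^^ t) x \<noteq> c0" "itin x = itin m"
  shows "inj_on (f ^^ t) (seg x m) \<and> (f ^^ t) ` seg x m = seg ((f ^^ t) x) ((f ^^ t) m)"
proof (induction t)
  case (Suc t)
  have "(f ^^ t) m \<noteq> c0" using assms(3)[of t] assms(4) itin_Star_iff by metis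
  then have "c0 \<notin> seg ((f ^^ t) x) ((f ^^ t) m)"
    using itin_eq_iff[OF assms(1,2,3), of t t] assms(4) by simp
  then have "inj_on f ((f ^^ t) ` seg x m)"
    "f ` (f ^^ t) ` seg x m = seg (f ((f ^^ t) x)) (f ((f ^^ t) m))"
    using inj_seg[of "(f ^^ t) x" "(f ^^ t) m"] Suc assms(1,2) by auto
  then show ?case
    using Suc comp_inj_on[of "f ^^ t" "seg x m" f] image_comp[of f "f ^^ t" "seg x m"]
    by (simp add: comp_def)
qed auto

text \<open>Minimality identifies the two orbits at a time when both are periodic; injectivity along
  the segment carries the equality back to the start.\<close>

lemma eventually_periodic_eqI:
  assumes "x \<in> T" "m \<in> T" "\<And>t. (f ^^ t) x \<noteq> c0" "itin x = itin m"
    and "eventually_periodic f x" "eventually_periodic f m"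
  shows "x = m"
proof -
  obtain s t where "is_periodic f ((f ^^ s) x)" "is_periodic f ((f ^^ t) m)"
    using assms by (auto simp: eventually_periodic_def)
  then have "is_periodic f ((f ^^ (t + s)) x)" "is_periodic f ((f ^^ (s + t)) m)"
    using is_periodic_funpow[of f "(f ^^ s) x" t] is_periodic_funpow[of f "(f ^^ t) m" s]
    by (simp_all add: funpow_add)
  moreover have "itin ((f ^^ (s + t)) x) = itin ((f ^^ (s + t)) m)"
    using assms(4) by (auto simp: itin_funpow)
  ultimately have "(f ^^ (s + t)) x = (f ^^ (s + t)) m"
    using minimal assms(1,2) unfolding minimal_hubbard_tree_def by (metis add.commute iter_in)
  then show ?thesis
    using same_itin_seg[OF assms(1-4), of "s + t"] seg_ends[OF assms(1,2)] by (auto dest: inj_onD)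
qed

end

section \<open>Symbolic tracking of directions\<close>

text \<open>For a point \<open>x\<close> with itinerary \<open>u\<close> and a point \<open>z\<close> with itinerary \<open>\<sigma>\<close>, the direction at
  \<open>(f ^^ t) x\<close> that is the image of the direction at \<open>x\<close> towards \<open>(f ^^ a) z\<close> points towards
  \<open>(f ^^ track \<sigma> u a t) z\<close>. When the critical point separates the two points, the image points
  towards the critical value, and the critical value may be replaced by \<open>z\<close>.\<close>

primrec track :: "(nat \<Rightarrow> symbol) \<Rightarrow> (nat \<Rightarrow> symbol) \<Rightarrow> nat \<Rightarrow> nat \<Rightarrow> nat" where
  "track \<sigma> u a 0 = a"
| "track \<sigma> u a (Suc t) = (if \<sigma> (track \<sigma> u a t) = u t then Suc (track \<sigma> u a t) else 0)"

lemma track_add: "track \<sigma> u a (s + t) = track \<sigma> (\<lambda>i. u (s + i)) (track \<sigma> u a s) t"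
  by (induction t) auto

text \<open>With \<open>u\<close> avoiding the itinerary of \<open>z\<close>, this is necessary for
  a point that follows \<open>u\<close> to lie between the two tracked points
  (\<open>between_never_both_cut\<close>); conversely it yields some such point
  (\<open>exists_follows\<close>).\<close>

definition never_both_cut :: "(nat \<Rightarrow> symbol) \<Rightarrow> (nat \<Rightarrow> symbol) \<Rightarrow> nat \<Rightarrow> nat \<Rightarrow> bool" where
  "never_both_cut \<sigma> u a b \<longleftrightarrow> (\<forall>t. \<sigma> (track \<sigma> u a t) = u t \<or> \<sigma> (track \<sigma> u b t) = u t)"

lemma never_both_cut_shift:
  "never_both_cut \<sigma> u a b \<Longrightarrow> never_both_cut \<sigma> (\<lambda>i. u (s + i)) (track \<sigma> u a s) (track \<sigma> u b s)"
  unfolding never_both_cut_def by (simp add: track_add[symmetric])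

text \<open>For the itinerary of \<open>z\<close> in place of \<open>\<sigma>\<close>, this prevents
  an orbit with itinerary \<open>u\<close> from meeting \<open>c0\<close> or
  \<open>z\<close>.\<close>

definition avoids :: "(nat \<Rightarrow> symbol) \<Rightarrow> (nat \<Rightarrow> symbol) \<Rightarrow> bool" where
  "avoids \<sigma> u \<longleftrightarrow> (\<forall>t. u t \<noteq> Star \<and> (\<lambda>i. u (t + i)) \<noteq> \<sigma>)"

lemma avoids_shift: "avoids \<sigma> u \<Longrightarrow> avoids \<sigma> (\<lambda>i. u (s + i))"
  by (simp add: avoids_def add.assoc[symmetric])

section \<open>Leading points, and directions seen from the near side of a characteristic
  point\<close>

context hub
begin

text \<open>A weakening of \<open>characteristic_point\<close> that, unlike periodicity, passes to
  the limits in \<open>leading_limit\<close>.\<close>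

definition leading :: "'a \<Rightarrow> bool" where
  "leading y \<longleftrightarrow> y \<in> T \<and> (\<forall>t. (f ^^ t) y \<noteq> c0) \<and> y \<in> seg c0 (f c0) \<and>
     (\<forall>t. (f ^^ t) y = y \<or> y \<notin> seg c0 ((f ^^ t) y))"

lemma characteristic_leading:
  assumes "characteristic_point T f c0 z"
  shows "leading z" "is_periodic f z" "z \<noteq> f c0"
proof -
  obtain n C D where z: "z \<in> T" "orb f z \<inter> orb f c0 = {}" "has_period f z n"
    and CD: "C \<in> components (T - {z})" "D \<in> components (T - {z})" "C \<noteq> D" "f c0 \<in> C" "c0 \<in> D"
    and k: "\<And>k. 0 < k \<Longrightarrow> k < n \<Longrightarrow> (f ^^ k) z \<in> D"
    using assms unfolding characteristic_point_def by blast
  show per: "is_periodic f z" using z(3) by (auto simp: is_periodic_def)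
  have disj: "(f ^^ t) z \<noteq> (f ^^ s) c0" for s t
    using z(2) by (auto simp: orb_def)
  show zc1: "z \<noteq> f c0" using disj[of 0 1] by simp
  have zc0: "(f ^^ t) z \<noteq> c0" for t using disj[of t 0] by simp
  have D: "D = connected_component_set (T - {z}) c0"
    using CD(2,5) by (metis components_iff connected_component_eq)
  have C: "C = connected_component_set (T - {z}) (f c0)"
    using CD(1,4) by (metis components_iff connected_component_eq)
  have "\<not> connected_component (T - {z}) c0 (f c0)"
    using C D CD(3) connected_component_eq[of "f c0" "T - {z}" c0] by auto
  then have "z \<in> seg c0 (f c0)"
    using connected_component_minus_iff[of c0 "f c0" z] zc1 zc0[of 0] by auto
  moreover have "(f ^^ t) z = z \<or> z \<notin> seg c0 ((f ^^ t) z)" for t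
  \<comment> \<open>Modulo the period, an iterate is \<open>z\<close> or one of those lying in the
    component of \<open>c0\<close>.\<close>
  proof (cases "t mod n = 0")
    case True
    have "(f ^^ (t mod n)) z = (f ^^ t) z" using z(3) funpow_mod_eq by (auto simp: has_period_def)
    then show ?thesis using True by simp
  next
    case False
    have "(f ^^ (t mod n)) z = (f ^^ t) z" using z(3) funpow_mod_eq by (auto simp: has_period_def)
    moreover have "(f ^^ (t mod n)) z \<in> D" using k[of "t mod n"] False z(3) by (auto simp: has_period_def)
    ultimately have cc: "connected_component (T - {z}) c0 ((f ^^ t) z)" using D by simp
    then have "(f ^^ t) z \<in> T - {z}" using connected_component_in by blast
    then show ?thesis using cc connected_component_minus_iff[of c0 "(f ^^ t) z" z] zc0[of 0] by auto
  qed
  ultimately show "leading z" using z(1) zc0 by (simp add: leading_def)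
qed

end

locale hub_characteristic = hub +
  fixes z
  assumes char: "characteristic_point T f c0 z"
begin

lemma z_in [simp]: "z \<in> T"
  and z_free: "(f ^^ t) z \<noteq> c0"
  and z_between: "z \<in> seg c0 (f c0)"
  and z_orbit: "(f ^^ t) z = z \<or> z \<notin> seg c0 ((f ^^ t) z)"
  using characteristic_leading(1)[OF char] by (auto simp: leading_def)

lemma z_periodic: "is_periodic f z" and z_ne_c1: "z \<noteq> f c0"
  using characteristic_leading[OF char] by auto

text \<open>The component of \<open>T - {z}\<close> containing \<open>c0\<close>, with
  \<open>z\<close> added; it contains the orbit of \<open>z\<close> but not the critical
  value.\<close>

definition inner :: "'a set" where
  "inner = {x \<in> T. x = z \<or> z \<notin> seg c0 x}"

lemma inner_in [simp]: "x \<in> inner \<Longrightarrow> x \<in> T"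
  by (simp add: inner_def)

lemma z_orbit_inner [simp]: "(f ^^ t) z \<in> inner"
  using z_orbit by (simp add: inner_def del: inner_in)

lemma z_inner [simp]: "z \<in> inner"
  by (simp add: inner_def del: inner_in)

lemma inner_convex:
  assumes "x \<in> inner" "y \<in> inner"
  shows "seg x y \<subseteq> inner"
proof
  fix w assume w: "w \<in> seg x y"
  have T: "x \<in> T" "y \<in> T" "w \<in> T" using assms w seg_subset[of x y] by auto
  have "w = z" if "z \<in> seg c0 w"
  proof -
    have "w = z" if "w \<in> seg c0 v" "v \<in> inner" for v
    proof -
      have "v \<in> T" using that by simp
      then have "z \<in> seg c0 v" using seg_mono[OF c0_in _ that(1) \<open>z \<in> seg c0 w\<close>] by blast
      then have "v = z" using that(2) by (simp add: inner_def del: inner_in)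
      then show ?thesis using seg_antisym[OF c0_in T(3) \<open>z \<in> seg c0 w\<close>] that(1) by simp
    qed
    moreover have "w \<in> seg c0 x \<or> w \<in> seg c0 y"
      using seg_triangle[OF T(1) c0_in T(2) w] seg_sym[OF T(1) c0_in] by auto
    ultimately show ?thesis using assms by blast
  qed
  then show "w \<in> inner" using T by (auto simp: inner_def simp del: inner_in)
qed

lemma z_between_inner:
  assumes "x \<in> inner"
  shows "z \<in> seg x (f c0)"
proof (cases "x = z")
  case True
  then show ?thesis using seg_ends by simp
next
  case False
  then have "z \<notin> seg c0 x" using assms by (simp add: inner_def del: inner_in)
  then show ?thesis
    using seg_triangle[of c0 x "f c0" z] z_between assms by auto
qed

lemma beyond_z: 
  assumes "v \<in> inner" "v \<in> seg z (f c0)"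
  shows "v = z"
proof -
  have T: "v \<in> T" "f c0 \<in> T" using assms by auto
  have "z \<in> seg (f c0) c0" "v \<in> seg (f c0) z"
    using z_between assms(2) seg_sym[OF c0_in T(2)] seg_sym[OF z_in T(2)] by auto
  then have "z \<in> seg v c0" using seg_order[OF T(2) c0_in] by blast
  then show ?thesis using assms(1) seg_sym[OF T(1) c0_in] by (auto simp: inner_def simp del: inner_in)
qed

lemma inner_seg_c1:
  assumes "x \<in> inner" "v \<in> inner" "v \<in> seg x (f c0)"
  shows "v \<in> seg x z"
proof -
  have "v \<in> seg x z \<or> v \<in> seg z (f c0)"
    using seg_split(1)[of x "f c0" z] z_between_inner assms by auto
  then show ?thesis using beyond_z assms seg_ends[of x z] by auto
qed

lemma c1_not_inner: "f c0 \<notin> inner"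
  using z_between z_ne_c1 by (simp add: inner_def del: inner_in)

text \<open>Seen from \<open>x\<close>, the critical value lies behind \<open>z\<close>; this is
  what allows \<open>track\<close> to restart at \<open>0\<close>.\<close>

lemma inner_swap:
  assumes "x \<in> inner" "x \<noteq> z" "Z \<in> T"
  shows "x \<in> seg (f c0) Z \<longleftrightarrow> x \<in> seg z Z"
proof -
  have "x \<notin> seg z (f c0)" using beyond_z assms by blast
  then show ?thesis using seg_same_side[of x z "f c0" Z] assms by auto
qed

text \<open>The orbit has to stay in \<open>inner\<close> so that \<open>inner_swap\<close> applies
  at every time.\<close>

definition follows :: "(nat \<Rightarrow> symbol) \<Rightarrow> 'a \<Rightarrow> bool" where
  "follows u x \<longleftrightarrow> x \<in> T \<and> itin x = u \<and> (\<forall>t. (f ^^ t) x \<in> inner)"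

lemma follows_shift: "follows u x \<Longrightarrow> follows (\<lambda>i. u (s + i)) ((f ^^ s) x)"
  unfolding follows_def by (auto simp: itin_funpow) (metis comp_apply funpow_add)

lemma follows_ne:
  assumes "follows u x" "avoids (itin z) u"
  shows "(f ^^ t) x \<noteq> c0" "(f ^^ t) x \<noteq> z"
proof -
  show "(f ^^ t) x \<noteq> c0"
    using assms itin_Star_iff[of x t] by (auto simp: follows_def avoids_def)
  have "itin ((f ^^ t) x) = (\<lambda>i. u (t + i))" using assms(1) by (auto simp: itin_funpow follows_def)
  then show "(f ^^ t) x \<noteq> z" using assms(2) by (auto simp: avoids_def)
qed

lemma f_trim_iff:
  assumes "follows u x" "avoids (itin z) u" "Z \<in> T"
  shows "(f ^^ Suc t) x \<in> seg (f (trim ((f ^^ t) x) ((f ^^ a) z))) Z \<longleftrightarrow>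
    (f ^^ Suc t) x \<in> seg ((f ^^ (if itin z a = u t then Suc a else 0)) z) Z"
proof -
  have "(f ^^ Suc t) x \<in> inner" using assms(1) unfolding follows_def by blast
  then have "(f ^^ Suc t) x \<in> seg (f c0) Z \<longleftrightarrow> (f ^^ Suc t) x \<in> seg z Z"
    using inner_swap follows_ne(2)[OF assms(1,2)] assms(3) by blast
  moreover have "trim ((f ^^ t) x) ((f ^^ a) z) = (if itin z a = u t then (f ^^ a) z else c0)"
    using trim_itin[of x z t a] assms(1) follows_ne(1)[OF assms(1,2)] by (auto simp: follows_def)
  ultimately show ?thesis by auto
qed

text \<open>Here \<open>P\<close> is arbitrary, so that points off the orbit of \<open>z\<close> can
  be tracked too, in particular \<open>p\<close> and the critical value.\<close>

lemma step_iff: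
  assumes "follows u x" "avoids (itin z) u" "P \<in> T"
  shows "(f ^^ t) x \<in> seg P ((f ^^ a) z) \<longleftrightarrow>
    (f ^^ Suc t) x \<in> seg (f (trim ((f ^^ t) x) P)) ((f ^^ (if itin z a = u t then Suc a else 0)) z)"
proof -
  let ?x = "(f ^^ t) x" and ?A = "(f ^^ a) z" and ?a = "if itin z a = u t then Suc a else 0"
  have T: "?x \<in> T" "?A \<in> T" using assms(1) by (auto simp: follows_def)
  then have T': "f (trim ?x P) \<in> T" "f (trim ?x ?A) \<in> T" "(f ^^ ?a) z \<in> T" using assms(3) by auto
  have "?x \<in> seg P ?A \<longleftrightarrow> f ?x \<in> seg (f (trim ?x ?A)) (f (trim ?x P))"
    using between_image_iff[OF T(1) assms(3) T(2) follows_ne(1)[OF assms(1,2)]] seg_sym[OF T'(1,2)] by simp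
  also have "\<dots> \<longleftrightarrow> f ?x \<in> seg ((f ^^ ?a) z) (f (trim ?x P))"
    using f_trim_iff[OF assms(1,2) T'(1), of t a] by simp
  finally show ?thesis using seg_sym[OF T'(1,3)] by simp
qed

lemma track_iff:
  assumes "follows u x" "avoids (itin z) u"
  shows "x \<in> seg ((f ^^ a) z) ((f ^^ b) z) \<longleftrightarrow>
    (f ^^ t) x \<in> seg ((f ^^ track (itin z) u a t) z) ((f ^^ track (itin z) u b t) z)"
proof (induction t)
  case (Suc t)
  let ?a = "track (itin z) u a t" and ?b = "track (itin z) u b t"
  have "(f ^^ t) x \<in> seg ((f ^^ ?a) z) ((f ^^ ?b) z) \<longleftrightarrow>
    (f ^^ Suc t) x \<in> seg (f (trim ((f ^^ t) x) ((f ^^ ?a) z))) ((f ^^ track (itin z) u b (Suc t)) z)"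
    using step_iff[OF assms, of "(f ^^ ?a) z" t ?b] by simp
  also have "\<dots> \<longleftrightarrow> (f ^^ Suc t) x \<in> seg ((f ^^ track (itin z) u a (Suc t)) z) ((f ^^ track (itin z) u b (Suc t)) z)"
    using f_trim_iff[OF assms, of "(f ^^ track (itin z) u b (Suc t)) z" t ?a] by simp
  finally show ?case using Suc by simp
qed simp

text \<open>If both directions were cut at the same time, both would turn into the one towards the
  critical value; the next iterate of \<open>x\<close> could be between them only by being the
  critical value, which is not inner.\<close>

lemma between_never_both_cut:
  assumes "follows u x" "avoids (itin z) u" "x \<in> seg ((f ^^ a) z) ((f ^^ b) z)"
  shows "never_both_cut (itin z) u a b"
  unfolding never_both_cut_def
proof (intro allI, rule ccontr)
  fix t
  let ?a = "track (itin z) u a t" and ?b = "track (itin z) u b t" and ?x = "(f ^^ t) x"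
  assume "\<not> (itin z ?a = u t \<or> itin z ?b = u t)"
  moreover have x: "x \<in> T" "itin x = u" using assms(1) by (auto simp: follows_def)
  ultimately have "trim ?x ((f ^^ ?a) z) = c0" "trim ?x ((f ^^ ?b) z) = c0"
    using trim_itin[OF x(1) z_in follows_ne(1)[OF assms(1,2)]] by auto
  moreover have "?x \<in> seg ((f ^^ ?a) z) ((f ^^ ?b) z)" using track_iff[OF assms(1,2)] assms(3) by blast
  ultimately have "f ?x \<in> seg (f c0) (f c0)"
    using between_image_iff[of ?x "(f ^^ ?a) z" "(f ^^ ?b) z"] x(1) follows_ne(1)[OF assms(1,2)] by auto
  then have "(f ^^ Suc t) x = f c0" by simp
  then show False using assms(1) c1_not_inner unfolding follows_def by metis
qed

text \<open>If the tracked directions are never both cut, then the common initial part of the two arcs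
  starting at \<open>x\<close> is never cut either.\<close>

lemma common_follows:
  assumes "follows u x" "avoids (itin z) u" "never_both_cut (itin z) u a b"
    and "m \<in> seg x ((f ^^ a) z)" "m \<in> seg x ((f ^^ b) z)"
  shows "follows u m"
proof -
  have x: "x \<in> T" "itin x = u" using assms(1) by (auto simp: follows_def)
  have m: "m \<in> T" using assms(4) seg_subset[of x "(f ^^ a) z"] x by auto
  have ne: "(f ^^ t) x \<noteq> c0" for t using follows_ne[OF assms(1,2)] by blast
  have xin: "(f ^^ t) x \<in> inner" for t using assms(1) by (simp add: follows_def)
  \<comment> \<open>Here the direction of \<open>a\<close> is the one not cut; otherwise the roles
    of \<open>a\<close> and \<open>b\<close> are exchanged.\<close>
  have step: "(f ^^ Suc t) m \<in> seg ((f ^^ Suc t) x) ((f ^^ (if itin z a = u t then Suc a else 0)) z) \<and>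
      (f ^^ Suc t) m \<in> seg ((f ^^ Suc t) x) ((f ^^ (if itin z b = u t then Suc b else 0)) z) \<and>
      itin m t = u t"
    if A: "itin z a = u t" and m0: "(f ^^ t) m \<in> seg ((f ^^ t) x) ((f ^^ a) z)"
      "(f ^^ t) m \<in> seg ((f ^^ t) x) ((f ^^ b) z)" for t a b
  proof -
    let ?x = "(f ^^ t) x" and ?m = "(f ^^ t) m" and ?A = "(f ^^ a) z" and ?B = "(f ^^ b) z"
    have T: "?x \<in> T" "?m \<in> T" "?A \<in> T" "?B \<in> T" using x m by auto
    have same: "c0 \<notin> seg ?x ((f ^^ c) z)" if "itin z c = u t" for c
      using itin_eq_iff[OF x(1) z_in ne z_free, of t c] x(2) that by simp
    have im: "f ` seg ?x ((f ^^ c) z) = seg (f ?x) (f ((f ^^ c) z))" if "itin z c = u t" for c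
      using inj_seg(2)[of ?x "(f ^^ c) z"] same[OF that] T by auto
    have fA: "f ?m \<in> seg (f ?x) (f ?A)" using im[OF A] m0(1) by blast
    have c0: "c0 \<notin> seg ?x ?m" using seg_mono[OF T(1,3) m0(1)] same[OF A] by blast
    then have "?m \<noteq> c0" using seg_ends(2)[OF T(1,2)] by auto
    then have "itin m t = u t" using itin_eq_iff[OF x(1) m ne, of t t] c0 x(2) by simp
    moreover have "f ?m \<in> seg (f ?x) ((f ^^ (if itin z b = u t then Suc b else 0)) z)"
    proof (cases "itin z b = u t")
      case True
      then show ?thesis using im[OF True] m0(2) by auto
    next
      \<comment> \<open>The arc towards \<open>?B\<close> is cut, but \<open>?m\<close> comes before
        \<open>c0\<close>. Its image is inner, so the segment to the critical value may be shortened
        to end at \<open>z\<close>.\<close>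
      case False
      then have B: "c0 \<in> seg ?x ?B"
        using itin_eq_iff[OF x(1) z_in ne z_free, of t b] x(2) by simp
      then have "?m \<in> seg ?x c0" using seg_linear[OF T(1,4) B m0(2)] c0 by blast
      then have "f ?m \<in> seg (f ?x) (f c0)" using inj_seg(2)[OF T(1) c0_in disjI2[OF refl]] by blast
      moreover have "f ?m \<in> inner"
        using fA inner_convex[of "f ?x" "f ?A"] xin[of "Suc t"] z_orbit_inner[of "Suc a"] by auto
      ultimately show ?thesis using inner_seg_c1[of "f ?x" "f ?m"] xin[of "Suc t"] False by simp
    qed
    ultimately show ?thesis using fA A by simp
  qed
  have main: "(f ^^ t) m \<in> seg ((f ^^ t) x) ((f ^^ track (itin z) u a t) z) \<and>
    (f ^^ t) m \<in> seg ((f ^^ t) x) ((f ^^ track (itin z) u b t) z)" for t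
  proof (induction t)
    case (Suc t)
    have "itin z (track (itin z) u a t) = u t \<or> itin z (track (itin z) u b t) = u t"
      using assms(3) by (simp add: never_both_cut_def)
    then show ?case using step Suc unfolding track.simps by blast
  qed (use assms in simp)
  have "itin m t = u t" for t
  proof -
    have "itin z (track (itin z) u a t) = u t \<or> itin z (track (itin z) u b t) = u t"
      using assms(3) by (simp add: never_both_cut_def)
    then show ?thesis using step main by blast
  qed
  moreover have "(f ^^ t) m \<in> inner" for t
    using main[of t] inner_convex[OF xin z_orbit_inner] by blast
  ultimately show ?thesis using m by (auto simp: follows_def)
qed

text \<open>The median of \<open>x\<close> and the two iterates of \<open>z\<close> has itinerary
  \<open>u\<close>. It is one of the iterates, hence periodic, or a branch point.\<close>

lemma median_follows:
  assumes "follows u x" "avoids (itin z) u" "never_both_cut (itin z) u a b"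
    and "x \<notin> seg ((f ^^ a) z) ((f ^^ b) z)"
  obtains m where "follows u m" "eventually_periodic f m" "m \<in> seg ((f ^^ a) z) ((f ^^ b) z)"
proof -
  let ?A = "(f ^^ a) z" and ?B = "(f ^^ b) z"
  have T: "x \<in> T" "?A \<in> T" "?B \<in> T" using assms(1) by (auto simp: follows_def)
  obtain m where m: "m \<in> T" "m \<in> seg x ?A" "m \<in> seg x ?B" "m \<noteq> x" "m \<in> seg ?A ?B"
    using common_of_not_between[OF T assms(4)] by metis
  have fm: "follows u m" using common_follows[OF assms(1-3) m(2,3)] .
  have "eventually_periodic f m"
  proof (cases "m = ?A \<or> m = ?B")
    case True
    then show ?thesis
      using is_periodic_funpow[OF z_periodic] unfolding eventually_periodic_def by (metis funpow_0)
  next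
    case False
    then have "branching m" unfolding branching_def using m T by metis
    then show ?thesis using branching_eventually_periodic follows_ne(1)[OF fm assms(2)] by blast
  qed
  then show ?thesis using that fm m(5) by blast
qed

text \<open>Otherwise the median would be a second eventually periodic point with the itinerary
  \<open>u\<close>.\<close>

lemma eventually_periodic_between:
  assumes "follows u x" "avoids (itin z) u" "never_both_cut (itin z) u a b" "eventually_periodic f x"
  shows "x \<in> seg ((f ^^ a) z) ((f ^^ b) z)"
proof (rule ccontr)
  assume not: "\<not> ?thesis"
  then obtain m where m: "follows u m" "eventually_periodic f m" "m \<in> seg ((f ^^ a) z) ((f ^^ b) z)"
    using median_follows assms by metis
  have "x = m"
    using eventually_periodic_eqI[of x m] follows_ne(1)[OF assms(1,2)] m assms(1,4)
    by (auto simp: follows_def)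
  then show False using m(3) not by simp
qed

end

context hub
begin

lemma cont_funpow: "continuous_on T (f ^^ t)"
proof (induction t)
  case (Suc t)
  have "(f ^^ t) ` T \<subseteq> T" by auto
  then have "continuous_on T (f \<circ> f ^^ t)"
    using Suc cont by (metis continuous_on_compose continuous_on_subset)
  then show ?case by simp
qed (simp add: id_def)

text \<open>If an iterate of \<open>b\<close> were strictly beyond \<open>b\<close>, then so would be the iterates of the nearby
  leading points, since the components of \<open>T - {b}\<close> are open.\<close>

lemma leading_limit:
  assumes s: "\<And>k. leading (s k)" "\<And>k. s k \<in> seg c0 b" "\<And>k. s k \<noteq> b" "s \<longlonglongrightarrow> b"
    and b: "b \<in> seg c0 (f c0)" "b \<noteq> f c0"
  shows "leading b"
proof -
  have bT: "b \<in> T" using b(1) seg_subset[of c0 "f c0"] by auto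
  have sT: "s k \<in> T" for k using s(1) by (simp add: leading_def)
  have ret: "(f ^^ t) b = b \<or> b \<notin> seg c0 ((f ^^ t) b)" for t
  proof (rule ccontr)
    let ?b = "(f ^^ t) b"
    assume neg: "\<not> (?b = b \<or> b \<notin> seg c0 ?b)"
    have btT: "?b \<in> T" using bT by simp
    have "openin (top_of_set T) {w \<in> T. b \<notin> seg ?b w}"
      using openin_not_between[OF btT bT] neg by blast
    moreover have "?b \<in> {w \<in> T. b \<notin> seg ?b w}" using neg bT by auto
    ultimately obtain U where U: "open U" "?b \<in> U" "U \<inter> T \<subseteq> {w \<in> T. b \<notin> seg ?b w}"
      unfolding openin_open by blast
    have "(\<lambda>k. (f ^^ t) (s k)) \<longlonglongrightarrow> ?b"
      using continuous_on_tendsto_compose[OF cont_funpow s(4) bT] sT by simp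
    then have "eventually (\<lambda>k. (f ^^ t) (s k) \<in> U) sequentially"
      using U(1,2) by (rule topological_tendstoD)
    then obtain k where "(f ^^ t) (s k) \<in> U" by (auto simp: eventually_sequentially)
    then have k: "b \<notin> seg ?b ((f ^^ t) (s k))" using U(3) sT by auto
    let ?w = "(f ^^ t) (s k)"
    have wT: "?w \<in> T" using sT by simp
    have "b \<in> seg ?b c0" using neg seg_sym[OF btT c0_in] by simp
    then have "b \<in> seg c0 ?w"
      using seg_same_side[OF bT btT wT c0_in k] seg_sym[OF wT c0_in] by simp
    then have "s k \<in> seg c0 ?w" using seg_mono[OF c0_in wT] s(2) by blast
    then have "?w = s k" using s(1)[of k] by (auto simp: leading_def)
    then show False
      using seg_antisym[OF c0_in sT _ s(2)] \<open>b \<in> seg c0 ?w\<close> s(2,3) seg_antisym[OF c0_in sT, of b k] by auto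
  qed
  moreover have "(f ^^ t) b \<noteq> c0" for t
  proof
    assume "(f ^^ t) b = c0"
    \<comment> \<open>The next iterate would be the critical value, which is strictly beyond
      \<open>b\<close>.\<close>
    then show False using ret[of "Suc t"] b by auto
  qed
  ultimately show ?thesis using bT b(1) by (simp add: leading_def)
qed

end

section \<open>Points with a prescribed itinerary\<close>

context hub_characteristic
begin

definition target :: "(nat \<Rightarrow> symbol) \<Rightarrow> nat \<Rightarrow> nat \<Rightarrow> nat \<Rightarrow> 'a set" where
  "target u a b t = seg ((f ^^ track (itin z) u a t) z) ((f ^^ track (itin z) u b t) z)"

text \<open>Unless both directions are cut, the segment between the two gates is the part of the
  target on the \<open>u t\<close> side of \<open>c0\<close>, including \<open>c0\<close> if one
  direction is cut.\<close>

definition gate :: "(nat \<Rightarrow> symbol) \<Rightarrow> nat \<Rightarrow> nat \<Rightarrow> 'a" where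
  "gate u a t = (if itin z (track (itin z) u a t) = u t then (f ^^ track (itin z) u a t) z else c0)"

lemma gate_in [simp]: "gate u a t \<in> T"
  by (simp add: gate_def)

lemma target_inner: "target u a b t \<subseteq> inner"
  unfolding target_def by (rule inner_convex) simp_all

lemma gates_subset_target:
  assumes "never_both_cut (itin z) u a b"
  shows "seg (gate u a t) (gate u b t) \<subseteq> target u a b t"
proof -
  let ?a = "track (itin z) u a t" and ?b = "track (itin z) u b t"
  have T: "(f ^^ ?a) z \<in> T" "(f ^^ ?b) z \<in> T" by auto
  have "itin z ?a = u t \<or> itin z ?b = u t" using assms by (simp add: never_both_cut_def)
  moreover have "c0 \<in> seg ((f ^^ ?a) z) ((f ^^ ?b) z)" if "itin z ?a \<noteq> itin z ?b"
    using itin_eq_iff[OF z_in z_in z_free z_free, of ?a ?b] that by simp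
  ultimately consider "itin z ?a = u t" "itin z ?b = u t"
    | "itin z ?a = u t" "itin z ?b \<noteq> u t" "c0 \<in> seg ((f ^^ ?a) z) ((f ^^ ?b) z)"
    | "itin z ?a \<noteq> u t" "itin z ?b = u t" "c0 \<in> seg ((f ^^ ?a) z) ((f ^^ ?b) z)" by metis
  then show ?thesis
  proof cases
    case 2
    then show ?thesis using seg_mono[OF T 2(3)] by (auto simp: gate_def target_def)
  next
    case 3
    then show ?thesis using seg_mono'[OF T 3(3)] by (auto simp: gate_def target_def)
  qed (simp add: gate_def target_def)
qed

text \<open>A cut end is mapped to the critical value, and the next tracked point \<open>z\<close>
  lies in front of it; so the image reaches at least as far as the next target.\<close>

lemma target_subset_image:
  assumes "never_both_cut (itin z) u a b"
  shows "target u a b (Suc t) \<subseteq> f ` seg (gate u a t) (gate u b t)"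
proof -
  let ?a = "track (itin z) u a t" and ?b = "track (itin z) u b t"
  let ?S = "seg (gate u a t) (gate u b t)"
  have ST: "?S \<subseteq> T" using seg_subset by simp
  have "connected (f ` ?S)"
    using connected_continuous_image[OF continuous_on_subset[OF cont ST]] seg_connected by simp
  moreover have "f ` ?S \<subseteq> T" using ST by auto
  moreover have "gate u a t \<in> ?S" "gate u b t \<in> ?S" using seg_ends by simp_all
  ultimately have *: "seg (f (gate u a t)) (f (gate u b t)) \<subseteq> f ` ?S"
    using seg_subset_connected by blast
  have "target u a b (Suc t) \<subseteq> seg (f (gate u a t)) (f (gate u b t))"
  proof -
    have T: "f ((f ^^ ?a) z) \<in> T" "f ((f ^^ ?b) z) \<in> T" by auto
    have zin: "z \<in> seg (f ((f ^^ c) z)) (f c0)" for c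
      using z_between_inner[of "(f ^^ Suc c) z"] z_orbit_inner[of "Suc c"] by simp
    have zin': "z \<in> seg (f c0) (f ((f ^^ c) z))" for c
      using zin[of c] seg_sym[of "f c0" "f ((f ^^ c) z)"] by simp
    consider "itin z ?a = u t" "itin z ?b = u t" | "itin z ?a = u t" "itin z ?b \<noteq> u t"
      | "itin z ?a \<noteq> u t" "itin z ?b = u t"
      using assms by (auto simp: never_both_cut_def)
    then show ?thesis
    proof cases
      case 2
      then show ?thesis using seg_mono[OF T(1) _ zin] by (auto simp: gate_def target_def)
    next
      case 3
      then show ?thesis using seg_mono'[OF _ T(2) zin'] by (auto simp: gate_def target_def)
    qed (simp add: gate_def target_def)
  qed
  then show ?thesis using * by blast
qed

text \<open>Any point between the gates other than \<open>c0\<close> is on the side of the uncut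
  end, and \<open>c0\<close> is excluded because its image is not inner.\<close>

lemma gates_itin:
  assumes "never_both_cut (itin z) u a b" "x \<in> T" "(f ^^ t) x \<in> seg (gate u a t) (gate u b t)"
    and "(f ^^ Suc t) x \<in> inner"
  shows "itin x t = u t"
proof -
  let ?w = "(f ^^ t) x"
  have wT: "?w \<in> T" using assms(2) by simp
  have wc0: "?w \<noteq> c0" using assms(4) c1_not_inner by auto
  have main: "itin x t = u t"
    if A: "itin z (track (itin z) u c t) = u t" and w: "?w \<in> seg (gate u c t) (gate u d t)" for c d
  proof -
    let ?c = "track (itin z) u c t" and ?d = "track (itin z) u d t"
    have gc: "gate u c t = (f ^^ ?c) z" using A by (simp add: gate_def)
    have T: "(f ^^ ?c) z \<in> T" "(f ^^ ?d) z \<in> T" by auto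
    have "c0 \<notin> seg ((f ^^ ?c) z) ?w"
    proof (cases "itin z ?d = u t")
      case True
      then have "c0 \<notin> seg ((f ^^ ?c) z) ((f ^^ ?d) z)"
        using itin_eq_iff[OF z_in z_in z_free z_free, of ?c ?d] A by simp
      moreover have "?w \<in> seg ((f ^^ ?c) z) ((f ^^ ?d) z)" using w True gc by (simp add: gate_def)
      ultimately show ?thesis using seg_mono[OF T] by blast
    next
      case False
      then have "?w \<in> seg ((f ^^ ?c) z) c0" using w gc by (simp add: gate_def)
      then show ?thesis using seg_antisym[OF T(1) c0_in] wc0 by blast
    qed
    then show ?thesis
      using itin_eq_iff[OF z_in assms(2) z_free wc0, of ?c] A by simp
  qed
  show ?thesis
    using main[of a b] main[of b a] assms(1,3) seg_sym[of "gate u a t" "gate u b t"]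
    by (auto simp: never_both_cut_def)
qed

text \<open>The targets cover one another in succession, so preimages can be chosen backwards from
  time \<open>N\<close>.\<close>

lemma pull_back:
  assumes "never_both_cut (itin z) u a b" "v \<in> target u a b N"
  shows "\<exists>x\<in>T. (\<forall>t<N. (f ^^ t) x \<in> seg (gate u a t) (gate u b t)) \<and> (f ^^ N) x = v"
  using assms(2)
proof (induction N arbitrary: v)
  case 0
  then have "v \<in> T" using target_inner inner_in by blast
  then show ?case by (intro bexI[of _ v]) auto
next
  case (Suc N)
  then obtain w where w: "w \<in> seg (gate u a N) (gate u b N)" "f w = v"
    using target_subset_image[OF assms(1)] by blast
  then have "w \<in> target u a b N" using gates_subset_target[OF assms(1)] by blast
  then obtain x where "x \<in> T" "\<forall>t<N. (f ^^ t) x \<in> seg (gate u a t) (gate u b t)" "(f ^^ N) x = w"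
    using Suc.IH by blast
  then show ?case using w by (intro bexI[of _ x]) (auto simp: less_Suc_eq)
qed

text \<open>Unlike in \<open>exists_follows\<close>, the \<open>N\<close>-th iterate is prescribed,
  and its orbit supplies the later symbols.\<close>

lemma pull_back_follows:
  assumes "never_both_cut (itin z) u a b" "v \<in> target u a b N" "follows (\<lambda>i. u (N + i)) v"
  obtains x where "follows u x" "x \<in> target u a b 0" "(f ^^ N) x = v"
proof -
  obtain x where x: "x \<in> T" "\<And>t. t < N \<Longrightarrow> (f ^^ t) x \<in> seg (gate u a t) (gate u b t)" "(f ^^ N) x = v"
    using pull_back[OF assms(1,2)] by blast
  have late: "(f ^^ (N + i)) x = (f ^^ i) v" for i
    using x(3) by (metis add.commute comp_apply funpow_add)
  have early: "(f ^^ t) x \<in> target u a b t" if "t < N" for t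
    using x(2)[OF that] gates_subset_target[OF assms(1)] by blast
  have inn: "(f ^^ t) x \<in> inner" for t
  proof (cases "t < N")
    case True
    then show ?thesis using early target_inner by blast
  next
    case False
    then show ?thesis using late[of "t - N"] assms(3) by (simp add: follows_def)
  qed
  have "itin x t = u t" for t
  proof (cases "t < N")
    case True
    then show ?thesis using gates_itin[OF assms(1) x(1) x(2) inn] by blast
  next
    case False
    have "itin x t = itin v (t - N)" using itin_funpow[of N x "t - N"] x(3) False by simp
    then show ?thesis using assms(3) False by (simp add: follows_def)
  qed
  then have "follows u x" using x(1) inn by (auto simp: follows_def)
  moreover have "x \<in> target u a b 0" using early[of 0] x(3) assms(2) by (cases "N = 0") auto
  ultimately show ?thesis using that x(3) by blast
qed

text \<open>Pull-backs of every finite length exist; compactness of \<open>T\<close> gives one point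
  for all times.\<close>

lemma exists_follows:
  assumes "never_both_cut (itin z) u a b"
  obtains x where "follows u x" "x \<in> target u a b 0"
proof -
  let ?K = "\<lambda>t. seg (gate u a t) (gate u b t)"
  have "compact T" using tree by (simp add: is_tree_def)
  have cl: "closed (T \<inter> (f ^^ t) -` ?K t)" for t
    using seg_compact[of "gate u a t" "gate u b t"] cont_funpow compact_imp_closed \<open>compact T\<close>
    by (intro continuous_closed_preimage) auto
  have "T \<inter> (\<Inter>t\<in>UNIV. T \<inter> (f ^^ t) -` ?K t) \<noteq> {}"
  proof (rule compact_imp_fip_image[OF \<open>compact T\<close>])
    fix I :: "nat set" assume "finite I"
    then obtain N where N: "\<And>t. t \<in> I \<Longrightarrow> t < N" by (metis finite_nat_bounded lessThan_iff subsetD)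
    obtain v where "v \<in> target u a b N"
      unfolding target_def using seg_ends(1)[OF iter_in[OF z_in] iter_in[OF z_in]] by blast
    then obtain x where "x \<in> T" "\<forall>t<N. (f ^^ t) x \<in> ?K t" using pull_back[OF assms] by blast
    then show "T \<inter> (\<Inter>t\<in>I. T \<inter> (f ^^ t) -` ?K t) \<noteq> {}" using N by blast
  qed (rule cl)
  then obtain x where x: "x \<in> T" "\<And>t. (f ^^ t) x \<in> ?K t" by blast
  then have h: "(f ^^ t) x \<in> target u a b t" for t using gates_subset_target[OF assms] by blast
  then have inn: "(f ^^ t) x \<in> inner" for t using target_inner by blast
  have "itin x t = u t" for t using gates_itin[OF assms x inn] .
  then have "follows u x" using x(1) inn by (auto simp: follows_def)
  then show ?thesis using that h[of 0] by simp
qed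

text \<open>If the \<open>N\<close>-th iterate of some point with itinerary \<open>u\<close> is off the second arc, then the branch
  point towards this arc is eventually periodic, hence lies on the \<open>N\<close>-th image of the first arc,
  and its preimage along \<open>u\<close> has the desired property.\<close>

lemma exists_follows_meeting:
  assumes "avoids (itin z) u" "never_both_cut (itin z) u a b"
    and "never_both_cut (itin z) (\<lambda>i. u (N + i)) c d"
  obtains x where "follows u x" "x \<in> seg ((f ^^ a) z) ((f ^^ b) z)"
    "(f ^^ N) x \<in> seg ((f ^^ c) z) ((f ^^ d) z)"
proof -
  obtain x where x: "follows u x" "x \<in> target u a b 0" using exists_follows[OF assms(2)] .
  show ?thesis
  proof (cases "(f ^^ N) x \<in> seg ((f ^^ c) z) ((f ^^ d) z)")
    case True
    then show ?thesis using that x by (simp add: target_def)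
  next
    case False
    obtain v where v: "follows (\<lambda>i. u (N + i)) v" "eventually_periodic f v"
        "v \<in> seg ((f ^^ c) z) ((f ^^ d) z)"
      using median_follows[OF follows_shift[OF x(1)] avoids_shift[OF assms(1)] assms(3) False] .
    have "v \<in> target u a b N"
      unfolding target_def
      using eventually_periodic_between[OF v(1) avoids_shift[OF assms(1)] never_both_cut_shift[OF assms(2)] v(2)] .
    then obtain y where "follows u y" "y \<in> target u a b 0" "(f ^^ N) y = v"
      using pull_back_follows[OF assms(2) _ v(1)] by blast
    then show ?thesis using that v(3) by (simp add: target_def)
  qed
qed

section \<open>Constraints on the itinerary of the critical value\<close>

lemma c0_inner: "c0 \<in> inner"
  using z_free[of 0] by (auto simp: inner_def simp del: inner_in)

lemma same_symbol_as_z: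
  assumes "y \<in> seg c0 z" "y \<noteq> c0"
  shows "itin y 0 = itin z 0"
proof -
  have yT: "y \<in> T" using assms(1) seg_subset[OF c0_in z_in] by blast
  have "y \<in> seg z c0" using assms(1) seg_sym[OF c0_in z_in] by simp
  then have "c0 \<notin> seg z y" using seg_antisym[OF z_in c0_in, of y] assms(2) by blast
  then show ?thesis using itin_eq_iff[OF z_in yT z_free, of 0 0] assms(2) by simp
qed

text \<open>The position of \<open>y\<close> between \<open>c0\<close> and \<open>z\<close> is
  turned into symbols: \<open>f y\<close> is between the critical value and \<open>f z\<close>, and
  \<open>inner_swap\<close> replaces the former by \<open>z\<close>.\<close>

lemma first_step:
  assumes "follows u y" "avoids (itin z) u" "y \<in> seg c0 z"
  shows "u 0 = itin z 0" "never_both_cut (itin z) (\<lambda>i. u (1 + i)) 0 1"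
proof -
  have ne: "y \<noteq> c0" using follows_ne(1)[OF assms(1,2), of 0] by simp
  show "u 0 = itin z 0"
    using same_symbol_as_z[OF assms(3) ne] assms(1) by (auto simp: follows_def)
  have "f y \<in> seg (f c0) (f z)" using inj_seg(2)[OF c0_in z_in disjI1[OF refl]] assms(3) by blast
  moreover have "f y \<in> inner" "f y \<noteq> z"
    using assms(1) follows_ne(2)[OF assms(1,2), of 1] unfolding follows_def
    by (auto dest: spec[of _ 1])
  ultimately have "f y \<in> seg ((f ^^ 0) z) ((f ^^ 1) z)" using inner_swap by simp
  then show "never_both_cut (itin z) (\<lambda>i. u (1 + i)) 0 1"
    using between_never_both_cut[OF follows_shift[OF assms(1), of 1] avoids_shift[OF assms(2)]] by simp
qed

text \<open>The segment from \<open>c0\<close> to \<open>z\<close> maps onto one that contains the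
  segment from \<open>z\<close> to \<open>f z\<close>, so a preimage can be taken on the side of
  \<open>c0\<close> prescribed by \<open>u 0\<close>.\<close>

lemma extend_first_step:
  assumes "follows (\<lambda>i. u (1 + i)) x" "x \<in> seg z (f z)" "u 0 = itin z 0"
  obtains y where "follows u y" "f y = x"
proof -
  have ST: "seg c0 z \<subseteq> T" using seg_subset by simp
  have "f ` seg c0 z = seg (f c0) (f z)" using inj_seg(2)[OF c0_in z_in disjI1[OF refl]] .
  moreover have "z \<in> seg (f c0) (f z)"
    using z_between_inner[of "f z"] z_orbit_inner[of 1] seg_sym[of "f c0" "f z"] by simp
  then have "x \<in> seg (f c0) (f z)" using seg_mono'[of "f c0" "f z" z x] assms(2) by simp
  ultimately have "x \<in> f ` seg c0 z" by simp
  then obtain y where y: "y \<in> seg c0 z" "f y = x" by (elim imageE) simp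
  have xin: "(f ^^ t) x \<in> inner" for t using assms(1) by (simp add: follows_def)
  have yT: "y \<in> T" using y(1) ST by blast
  have sh: "(f ^^ Suc t) y = (f ^^ t) x" for t using y(2) by (simp add: funpow_swap1)
  have "y \<noteq> c0" using y(2) xin[of 0] c1_not_inner by auto
  then have "itin y 0 = u 0" using same_symbol_as_z[OF y(1)] assms(3) by simp
  moreover have "itin y (Suc t) = u (Suc t)" for t
  proof -
    have "itin y (Suc t) = itin x t" using itin_funpow[of 1 y t] y(2) by simp
    then show ?thesis using assms(1) by (simp add: follows_def)
  qed
  ultimately have "itin y t = u t" for t by (cases t) auto
  moreover have "(f ^^ t) y \<in> inner" for t
  proof (cases t)
    case 0
    then show ?thesis using inner_convex[OF c0_inner z_inner] y(1) by auto
  next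
    case (Suc n)
    then show ?thesis using sh xin by metis
  qed
  ultimately have "follows u y" using yT by (auto simp: follows_def)
  then show ?thesis using that y(2) by blast
qed

text \<open>The direction towards \<open>P\<close> follows the orbit of \<open>P\<close> until the
  first mismatch \<open>j\<close>, where it is cut and becomes the one towards
  \<open>z\<close>.\<close>

lemma split_iff:
  assumes "follows u x" "avoids (itin z) u" "P \<in> T"
    and "\<And>i. i < j \<Longrightarrow> itin P i = u i \<or> itin P i = Star" "itin P j \<noteq> u j"
  shows "x \<in> seg P z \<longleftrightarrow>
    (f ^^ Suc j) x \<in> seg z ((f ^^ track (itin z) u 0 (Suc j)) z)"
proof -
  have x: "x \<in> T" "itin x = u" using assms(1) by (auto simp: follows_def)
  have tr: "trim ((f ^^ t) x) ((f ^^ t) P) = (if itin P t = u t then (f ^^ t) P else c0)" for t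
    using trim_itin[OF x(1) assms(3) follows_ne(1)[OF assms(1,2)]] x(2) by auto
  have "t \<le> j \<Longrightarrow> x \<in> seg P z \<longleftrightarrow> (f ^^ t) x \<in> seg ((f ^^ t) P) ((f ^^ track (itin z) u 0 t) z)" for t
  proof (induction t)
    case (Suc t)
    \<comment> \<open>At a star the iterate of \<open>P\<close> is \<open>c0\<close> itself, so
      trimming changes nothing.\<close>
    have "trim ((f ^^ t) x) ((f ^^ t) P) = (f ^^ t) P"
      using assms(4)[of t] Suc.prems tr[of t] itin_Star_iff[of P t] by auto
    then show ?case
      using Suc step_iff[OF assms(1,2), of "(f ^^ t) P" t "track (itin z) u 0 t"] assms(3) by simp
  qed simp
  then have "x \<in> seg P z \<longleftrightarrow> (f ^^ j) x \<in> seg ((f ^^ j) P) ((f ^^ track (itin z) u 0 j) z)" by simp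
  also have "\<dots> \<longleftrightarrow> (f ^^ Suc j) x \<in> seg (f c0) ((f ^^ track (itin z) u 0 (Suc j)) z)"
    using step_iff[OF assms(1,2), of "(f ^^ j) P" j "track (itin z) u 0 j"] assms(3,5) tr[of j] by simp
  also have "\<dots> \<longleftrightarrow> (f ^^ Suc j) x \<in> seg z ((f ^^ track (itin z) u 0 (Suc j)) z)"
  proof (rule inner_swap)
    show "(f ^^ Suc j) x \<in> inner" using assms(1) unfolding follows_def by blast
    show "(f ^^ Suc j) x \<noteq> z" using follows_ne(2)[OF assms(1,2)] .
  qed simp
  finally show ?thesis .
qed

text \<open>If the first mismatch were at \<open>j\<close>, a point satisfying both symbolic
  conditions would lie between the critical value and \<open>z\<close>, although it is inner and
  distinct from \<open>z\<close>.\<close>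

lemma no_split_off_kneading:
  assumes "avoids (itin z) u" "u 0 = itin z 0" "never_both_cut (itin z) (\<lambda>i. u (1 + i)) 0 1"
    and "never_both_cut (itin z) (\<lambda>i. u (Suc j + i)) 0 (track (itin z) u 0 (Suc j))"
    and "\<And>i. i < j \<Longrightarrow> itin (f c0) i = u i \<or> itin (f c0) i = Star"
  shows "itin (f c0) j = u j"
proof (rule ccontr)
  assume neq: "itin (f c0) j \<noteq> u j"
  \<comment> \<open>Time \<open>Suc j\<close> of the desired point \<open>y\<close> is time
    \<open>j\<close> of its image \<open>x\<close>, which is constructed first.\<close>
  have "never_both_cut (itin z) (\<lambda>i. u (1 + (j + i))) 0 (track (itin z) u 0 (Suc j))"
    using assms(4) by simp
  then obtain x where x: "follows (\<lambda>i. u (1 + i)) x" "x \<in> seg ((f ^^ 0) z) ((f ^^ 1) z)"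
      "(f ^^ j) x \<in> seg ((f ^^ 0) z) ((f ^^ track (itin z) u 0 (Suc j)) z)"
    using exists_follows_meeting[OF avoids_shift[OF assms(1)] assms(3)] by metis
  then obtain y where y: "follows u y" "f y = x" using extend_first_step[of u x] assms(2) by auto
  have "(f ^^ Suc j) y = (f ^^ j) x" using y(2) by (simp add: funpow_swap1)
  then have "(f ^^ Suc j) y \<in> seg z ((f ^^ track (itin z) u 0 (Suc j)) z)" using x(3) by simp
  then have "y \<in> seg (f c0) z" using split_iff[OF y(1) assms(1) _ assms(5) neq] by simp
  moreover have "y \<in> inner" "y \<noteq> z"
    using y(1) follows_ne(2)[OF y(1) assms(1), of 0] unfolding follows_def by (auto dest: spec[of _ 0])
  ultimately show False using inner_swap[of y z] by simp
qed

text \<open>If the critical value agreed with \<open>u\<close> up to stars, then \<open>c0\<close>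
  would never lie strictly between its orbit and that of a point following \<open>u\<close>. The
  point \<open>z\<close> is between the two, so it would have the itinerary \<open>u\<close> as
  well.\<close>

lemma no_shadowing_kneading:
  assumes "avoids (itin z) u" "u 0 = itin z 0" "never_both_cut (itin z) (\<lambda>i. u (1 + i)) 0 1"
  shows "\<exists>i. itin (f c0) i \<noteq> u i \<and> itin (f c0) i \<noteq> Star"
proof (rule ccontr)
  assume neg: "\<not> ?thesis"
  obtain x where "follows (\<lambda>i. u (1 + i)) x" "x \<in> target (\<lambda>i. u (1 + i)) 0 1 0"
    using exists_follows[OF assms(3)] .
  then obtain y where y: "follows u y" using extend_first_step[of u x] assms(2) by (auto simp: target_def)
  have yT: "y \<in> T" "itin y = u" "y \<in> inner"
    using y unfolding follows_def by (auto dest: spec[of _ 0])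
  have ne: "(f ^^ t) y \<noteq> c0" for t using follows_ne(1)[OF y assms(1)] .
  have cross: "c0 \<in> seg ((f ^^ t) y) ((f ^^ t) (f c0)) \<Longrightarrow> c0 = (f ^^ t) (f c0)" for t
  proof (rule ccontr)
    assume c: "c0 \<in> seg ((f ^^ t) y) ((f ^^ t) (f c0))" "c0 \<noteq> (f ^^ t) (f c0)"
    then have "itin (f c0) t = u t" using neg itin_Star_iff[of "f c0" t] by metis
    then show False using itin_eq_iff[OF yT(1) f_in[OF c0_in] ne, of t t] c yT(2) by auto
  qed
  have "(f ^^ t) z \<in> seg ((f ^^ t) y) ((f ^^ t) (f c0))" for t
  proof (induction t)
    case 0
    then show ?case using z_between_inner[OF yT(3)] by simp
  next
    case (Suc t)
    then show ?case
      using inj_seg(2)[of "(f ^^ t) y" "(f ^^ t) (f c0)"] cross[of t] yT(1) by auto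
  qed
  then have "c0 \<notin> seg ((f ^^ t) y) ((f ^^ t) z)" for t
  proof -
    assume *: "\<And>t. (f ^^ t) z \<in> seg ((f ^^ t) y) ((f ^^ t) (f c0))"
    let ?y = "(f ^^ t) y" and ?c = "(f ^^ t) (f c0)" and ?z = "(f ^^ t) z"
    have T: "?y \<in> T" "?c \<in> T" using yT(1) by auto
    show ?thesis
    proof
      assume c: "c0 \<in> seg ?y ?z"
      then have "c0 = ?c" using seg_mono[OF T *] cross by blast
      then have "?z = c0" using seg_antisym[OF T(1) c0_in _ c] *[of t] by simp
      then show False using z_free by simp
    qed
  qed
  then have "itin y t = itin z t" for t
    using itin_eq_iff[OF yT(1) z_in ne z_free, of t t] by simp
  then have "u = itin z" using yT(2) by auto
  then show False using assms(1) by (auto simp: avoids_def dest: spec[of _ 0])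
qed

text \<open>An iterate of \<open>y\<close> beyond \<open>z\<close> would be beyond \<open>y\<close>,
  hence equal to \<open>y\<close>, which is before \<open>z\<close>. An iterate with the itinerary
  of \<open>z\<close> would be \<open>z\<close> by minimality.\<close>

lemma leading_follows:
  assumes "leading y" "eventually_periodic f y" "y \<in> seg c0 z" "y \<noteq> z"
  shows "follows (itin y) y" "avoids (itin z) (itin y)"
proof -
  have y: "y \<in> T" "\<And>t. (f ^^ t) y \<noteq> c0" "\<And>t. (f ^^ t) y = y \<or> y \<notin> seg c0 ((f ^^ t) y)"
    using assms(1) by (auto simp: leading_def)
  have far: "z \<notin> seg c0 ((f ^^ t) y)" for t
  proof
    assume z: "z \<in> seg c0 ((f ^^ t) y)"
    then have "y \<in> seg c0 ((f ^^ t) y)" using seg_mono[OF c0_in _ z assms(3)] y(1) by simp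
    then have "(f ^^ t) y = y" using y(3) by blast
    then show False using seg_antisym[OF c0_in y(1), of z] z assms(3,4) by simp
  qed
  then show "follows (itin y) y" using y(1) by (simp add: follows_def inner_def del: inner_in)
  have "itin ((f ^^ t) y) \<noteq> itin z" for t
  proof
    assume eq: "itin ((f ^^ t) y) = itin z"
    have "(f ^^ s) ((f ^^ t) y) \<noteq> c0" for s using y(2)[of "s + t"] by (simp add: funpow_add)
    moreover have "eventually_periodic f z"
      using z_periodic unfolding eventually_periodic_def by (metis funpow_0)
    ultimately have "(f ^^ t) y = z"
      using eventually_periodic_eqI[OF _ z_in _ eq] y(1) eventually_periodic_funpow[OF assms(2)] by simp
    then show False using far[of t] seg_ends(2)[OF c0_in z_in] by simp
  qed
  moreover have "itin ((f ^^ t) y) = (\<lambda>i. itin y (t + i))" for t by (auto simp: itin_funpow)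
  ultimately show "avoids (itin z) (itin y)"
    using y(2) itin_Star_iff by (auto simp: avoids_def)
qed

end

section \<open>Comparison of the two trees\<close>

lemma hub_characteristicI:
  assumes "minimal_hubbard_tree T f c0" "characteristic_point T f c0 z"
  shows "hub_characteristic T f c0 z"
proof
  show "f c0 \<noteq> c0"
  proof
    assume eq: "f c0 = c0"
    obtain C D where "C \<in> components (T - {z})" "D \<in> components (T - {z})" "C \<noteq> D" "f c0 \<in> C" "c0 \<in> D"
      using assms(2) unfolding characteristic_point_def by blast
    \<comment> \<open>The critical value would lie in two distinct components.\<close>
    then show False using eq components_nonoverlap by (metis disjoint_iff)
  qed
qed (use assms in auto)

text \<open>Both alternatives of the theorem reduce to this, with \<open>y\<close> the given
  characteristic point or \<open>b\<close>. The position of \<open>y\<close> passes to the second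
  tree as symbolic conditions from \<open>leading_follows\<close>, \<open>first_step\<close> and
  \<open>between_never_both_cut\<close>.\<close>

lemma no_common_characteristic_itinerary:
  assumes "hub_characteristic T f c0 z" "hub_characteristic T' f' c0' z'"
    and eq: "itinerary T' f' c0' z' = itinerary T f c0 z"
    and y: "hub.leading T f c0 y" "eventually_periodic f y" "y \<in> arc_cc T c0 z" "y \<noteq> z"
    and p: "p \<in> T" "y \<in> arc_cc T p z"
    and kneading: "\<And>i. itinerary T' f' c0' (f' c0') i = itinerary T f c0 p i \<or>
        itinerary T' f' c0' (f' c0') i = Star"
  shows False
proof -
  interpret A: hub_characteristic T f c0 z by fact
  interpret B: hub_characteristic T' f' c0' z' by fact
  define u where "u = A.itin y"
  have u: "A.follows u y" "avoids (A.itin z) u"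
    using A.leading_follows[OF y] by (auto simp: u_def)
  note first = A.first_step[OF u y(3)]
  \<comment> \<open>The second critical value differs from \<open>u\<close> at an entry that is no
    star, hence so does \<open>p\<close>.\<close>
  obtain i where "B.itin (f' c0') i \<noteq> u i" "B.itin (f' c0') i \<noteq> Star"
    using B.no_shadowing_kneading[of u] u(2) first eq by auto
  then have "A.itin p i \<noteq> u i" using kneading[of i] by auto
  define j where "j = (LEAST i. A.itin p i \<noteq> u i)"
  have j: "A.itin p j \<noteq> u j" unfolding j_def using \<open>A.itin p i \<noteq> u i\<close> by (rule LeastI)
  have lt: "A.itin p i = u i" if "i < j" for i using not_less_Least that unfolding j_def by blast
  let ?s = "track (A.itin z) u 0 (Suc j)"
  \<comment> \<open>That \<open>y\<close> lies between \<open>p\<close> and \<open>z\<close>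
    becomes, after the first mismatch \<open>j\<close>, a condition on symbols, and in this form it
    passes to the second tree.\<close>
  have "(f ^^ Suc j) y \<in> arc_cc T z ((f ^^ ?s) z)"
    using A.split_iff[OF u p(1) _ j] lt p(2) by blast
  then have "never_both_cut (A.itin z) (\<lambda>i. u (Suc j + i)) 0 ?s"
    using A.between_never_both_cut[OF A.follows_shift[OF u(1)] avoids_shift[OF u(2)], of "Suc j" 0 ?s]
    by simp
  then have "B.itin (f' c0') j = u j"
    using B.no_split_off_kneading[of u j] u(2) first eq kneading lt by metis
  then show False using kneading[of j] j u(2) by (auto simp: avoids_def)
qed

context hub
begin

text \<open>The median of \<open>c0\<close>, \<open>f c0\<close> and \<open>p\<close> is not beyond
  \<open>b\<close>, by the last hypothesis, nor can \<open>b\<close> be beyond it on both segments;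
  so they coincide.\<close>

lemma branch_point_between:
  assumes "p \<in> T" "b \<in> seg c0 (f c0)" "b \<in> seg c0 p"
    and "\<And>m. m \<in> seg c0 (f c0) \<Longrightarrow> m \<in> seg c0 p \<Longrightarrow> m \<in> seg c0 b"
  shows "b \<in> seg p (f c0)"
proof -
  have bT: "b \<in> T" using assms(1,3) seg_subset[of c0 p] by auto
  obtain m where m: "m \<in> T" "m \<in> seg c0 (f c0)" "m \<in> seg (f c0) p" "m \<in> seg c0 p"
    using seg_median[of c0 "f c0" p] assms(1) by auto
  have mb: "m \<in> seg c0 b" using assms(4) m by blast
  have "b \<in> seg m (f c0)" "b \<in> seg m p"
    using seg_order[OF c0_in _ assms(2) mb] seg_order[OF c0_in assms(1) assms(3) mb] by auto
  then have "b = m"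
    using seg_split(2)[of "f c0" p m] m assms(1) seg_sym[of m "f c0"] by auto
  then show ?thesis using m(3) seg_sym[of "f c0" p] assms(1) by simp
qed

end

theorem lemma4p5:
  fixes T :: "'a::metric_space set" and f :: "'a \<Rightarrow> 'a" and c0 p b z :: 'a
    and T' :: "'b::metric_space set" and f' :: "'b \<Rightarrow> 'b" and c0' :: 'b
    and n :: nat and \<nu> \<tau> \<nu>' :: "nat \<Rightarrow> symbol"
  assumes "minimal_hubbard_tree T f c0"
    and "kneading_sequence T f c0 = \<nu>"
    and "p \<in> T" and "has_period f p n" and "\<not> precritical f c0 p"
    and "\<tau> = itinerary T f c0 p"
    and "b \<in> T"
    and "arc_oc T c0 (f c0) \<inter> arc_oc T c0 p = arc_oc T c0 b"
    and "arc_oc T c0 b \<noteq> {}"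
    and "\<nu>' = A_inv n \<tau>"
    and "minimal_hubbard_tree T' f' c0'"
    and "kneading_sequence T' f' c0' = \<nu>'"
    and "z \<in> arc_oo T b (f c0)"
    and "characteristic_point T f c0 z"
    and "(\<exists>y. characteristic_point T f c0 y \<and> y \<noteq> p \<and> y \<in> arc_co T b z) \<or>
         (\<exists>s. (\<forall>k. characteristic_point T f c0 (s k) \<and> s k \<in> arc_oo T c0 b) \<and> s \<longlonglongrightarrow> b)"
  shows "\<not> (\<exists>z'\<in>T'. characteristic_point T' f' c0' z' \<and>
               itinerary T' f' c0' z' = itinerary T f c0 z)"
proof
  assume "\<exists>z'\<in>T'. characteristic_point T' f' c0' z' \<and> itinerary T' f' c0' z' = itinerary T f c0 z"
  then obtain z' where z': "characteristic_point T' f' c0' z'" "itinerary T' f' c0' z' = itinerary T f c0 z"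
    by blast
  have loc: "hub_characteristic T f c0 z" "hub_characteristic T' f' c0' z'"
    using hub_characteristicI assms z' by blast+
  interpret A: hub_characteristic T f c0 z by (rule loc(1))
  have c1T: "f c0 \<in> T" by simp
  \<comment> \<open>The half-open segment from \<open>c0\<close> to itself is empty.\<close>
  have "b \<noteq> c0" using assms(9) by (auto simp: arc_oc_def)
  then have "b \<in> arc_oc T c0 b" using A.seg_ends(2)[OF A.c0_in assms(7)] by (simp add: arc_oc_def)
  then have b: "b \<in> A.seg c0 (f c0)" "b \<in> A.seg c0 p" using assms(8) by (auto simp: arc_oc_def)
  have "m \<in> A.seg c0 b" if "m \<in> A.seg c0 (f c0)" "m \<in> A.seg c0 p" for m
    using assms(8) that A.seg_ends(1)[OF A.c0_in assms(7)] by (cases "m = c0") (auto simp: arc_oc_def)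
  then have bp: "b \<in> A.seg p (f c0)" using A.branch_point_between[OF assms(3) b] by blast
  have z: "z \<in> A.seg b (f c0)" "z \<noteq> b" "z \<noteq> f c0" using assms(13) by (auto simp: arc_oo_def)
  then have "b \<noteq> f c0" by auto
  have zc: "z \<in> A.seg (f c0) b" using z(1) A.seg_sym[OF c1T assms(7)] by simp
  have "b \<in> A.seg (f c0) c0" "b \<in> A.seg (f c0) p"
    using b bp A.seg_sym[OF c1T A.c0_in] A.seg_sym[OF c1T assms(3)] by auto
  then have bz: "b \<in> A.seg c0 z" "b \<in> A.seg p z"
    using A.seg_order[OF c1T A.c0_in _ zc] A.seg_order[OF c1T assms(3) _ zc]
      A.seg_sym[OF A.z_in A.c0_in] A.seg_sym[OF A.z_in assms(3)] by auto
  have p_per: "is_periodic f p" using assms(4) by (auto simp: is_periodic_def)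
  have per: "eventually_periodic f x" if "is_periodic f x" for x
    using that unfolding eventually_periodic_def by (metis funpow_0)
  have "\<exists>y. A.leading y \<and> eventually_periodic f y \<and> y \<in> A.seg b z \<and> y \<noteq> z"
    using assms(15)
  proof (elim disjE exE conjE)
    fix y assume "characteristic_point T f c0 y" "y \<in> arc_co T b z"
    then show ?thesis
      using A.characteristic_leading[of y] per by (auto simp: arc_co_def)
  next
    fix s assume s: "\<forall>k. characteristic_point T f c0 (s k) \<and> s k \<in> arc_oo T c0 b" "s \<longlonglongrightarrow> b"
    have lb: "A.leading b"
    proof (rule A.leading_limit[OF _ _ _ s(2) b(1) \<open>b \<noteq> f c0\<close>])
      show "A.leading (s k)" "s k \<in> A.seg c0 b" "s k \<noteq> b" for k
        using s(1) A.characteristic_leading(1) by (auto simp: arc_oo_def)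
    qed
    have "eventually_periodic f b"
    \<comment> \<open>Either \<open>b\<close> is the periodic point \<open>p\<close>, or it
      separates \<open>c0\<close>, the critical value and \<open>p\<close> from one another and is a
      branch point.\<close>
    proof (cases "b = p")
      case True
      then show ?thesis using per p_per by simp
    next
      case False
      have "A.branching b"
        unfolding A.branching_def
      proof (intro conjI exI)
        show "b \<in> A.seg c0 (f c0)" "b \<in> A.seg (f c0) p" "b \<in> A.seg c0 p" by fact+
      qed (use assms(3,7) False \<open>b \<noteq> c0\<close> \<open>b \<noteq> f c0\<close> in auto)
      then show ?thesis using A.branching_eventually_periodic lb by (simp add: A.leading_def)
    qed
    then show ?thesis using lb z(2) A.seg_ends(1)[OF assms(7) A.z_in] by blast
  qed
  then obtain y where y: "A.leading y" "eventually_periodic f y" "y \<in> A.seg b z" "y \<noteq> z" by blast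
  have "y \<in> A.seg c0 z" "y \<in> A.seg p z"
    using A.seg_mono'[OF A.c0_in A.z_in bz(1) y(3)] A.seg_mono'[OF assms(3) A.z_in bz(2) y(3)] by auto
  \<comment> \<open>\<open>A_inv\<close> alters \<open>\<tau>\<close> only by inserting
    stars.\<close>
  moreover have "itinerary T' f' c0' (f' c0') i = itinerary T f c0 p i \<or>
      itinerary T' f' c0' (f' c0') i = Star" for i
    using assms(6,10,12) by (auto simp: kneading_sequence_def A_inv_def)
  ultimately show False
    using no_common_characteristic_itinerary[OF loc z'(2) y(1,2) _ y(4) assms(3)] by blast
qed

end
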